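(* For every $T>0$ and every measurable subset $\omega$ of $\Omega$, $$2\,C_{T,\mathrm{rand}}^{(W)}(\chi_\omega) = C_{T,\mathrm{rand}}^{(S)}(\chi_\omega)= T\inf_{j\in\mathbb{N}^*}\int_\omega\phi_j(x)^2 \, dV_g = T J(\chi_\omega).$$
   Context: Setting. $(M,g)$ is a smooth $n$-dimensional Riemannian manifold ($n\ge 1$), $\Omega$ is a bounded connected open subset of $M$ (the case $\partial\Omega=\emptyset$ is allowed; then $\Omega$ is a compact connected Riemannian manifold), and $V_g$ is the Riemannian volume measure; measurability is with respect to $V_g$. If $\partial\Omega\ne\emptyset$, one of the following boundary conditions $By=0$ on $\partial\Omega$ is fixed: Dirichlet ($By=y_{|\partial\Omega}$); Neumann ($By=\frac{\partial y}{\partial n}_{|\partial\Omega}$); mixed Dirichlet-Neumann ($By=\chi_{\Gamma_0}y_{|\partial\Omega}+\chi_{\Gamma_1}\frac{\partial y}{\partial n}_{|\partial\Omega}$ with $\partial\Omega=\Gamma_0\cup\Gamma_1$, $\Gamma_0\cap\Gamma_1=\emptyset$); Robin ($By=\frac{\partial y}{\partial n}_{|\partial\Omega}+\beta y_{|\partial\Omega}$, with $\beta\ge0$ bounded measurable on $\partial\Omega$, $\int_{\partial\Omega}\beta>0$). $X=\{y\in L^2(\Omega,\mathbb{C}) : \int_\Omega y\,dV_g=0\}$ in the Neumann and boundaryless cases, and $X=L^2(\Omega,\mathbb{C})$ otherwise. $A=-\triangle_g$ with domain $D(A)=\{y\in X : Ay\in X,\ By=0\}$ is a positive selfadjoint operator.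 $(\phi_j)_{j\in\mathbb{N}^*}$ is a fixed orthonormal Hilbertian basis of $X$ of real-valued eigenfunctions of $A$, with $A\phi_j=\lambda_j^2\phi_j$, $\lambda_j>0$. $\chi_\omega$ is the characteristic function of $\omega$, and $J(\chi_\omega)=\inf_{j\in\mathbb{N}^*}\int_\omega\phi_j(x)^2\,dV_g$. Randomized observability constants. Let $(\beta_{1,j}^\nu)_{j\in\mathbb{N}^*}$, $(\beta_{2,j}^\nu)_{j\in\mathbb{N}^*}$ and $(\beta_j^\nu)_{j\in\mathbb{N}^*}$ be sequences of independent Bernoulli random variables on a probability space $(\mathcal{X},\mathcal{A},\mathbb{P})$ (with $\nu\in\mathcal X$), each taking the values $\pm1$ with probability $\frac12$, and with $\mathbb{E}(\beta_{1,j}^\nu\beta_{2,k}^\nu)=0$ for all $j,k$; $\mathbb{E}$ denotes expectation. Then $$C_{T,\mathrm{rand}}^{(W)}(\chi_\omega)=\frac{1}{2}\inf_{\substack{(\lambda_{j}a_j),(\lambda_{j}b_j)\in\ell^2(\mathbb{C})\\ \sum_{j}\lambda_{j}^2( \vert a_j \vert ^2+ \vert b_j \vert ^2)=1}} \mathbb{E}\left( \int_0^T \int_\omega\Big\vert\sum_{j=1}^{+\infty}\lambda_{j}\left(\beta_{1,j}^\nu a_je^{i\lambda_jt}-\beta_{2,j}^\nu b_je^{-i\lambda_jt}\right)\phi_j(x) \Big\vert^2\, dV_g \, dt \right),$$ $$C_{T,\mathrm{rand}}^{(S)}(\chi_\omega)=\inf_{\substack{(\lambda_{j}^2c_j)\in\ell^2(\mathbb{C})\\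 \sum_{j} \lambda_{j}^4\vert c_j \vert ^2=1}}\mathbb{E}\left( \int_0^T\int_\omega \Big\vert\sum_{j=1}^{+\infty}\lambda_{j}^2\beta_j^\nu c_je^{i\lambda_j^2t}\phi_j(x)\Big\vert^2\, dV_g\, dt \right).$$ *)

theory Defs
  imports "HOL-Probability.Probability"
begin

section \<open>Smooth manifolds, through an atlas\<close>

text \<open>
  The manifold is a Hausdorff second countable type \<open>'m\<close> with an atlas of charts into
  \<open>real ^ 'n\<close>, so that its dimension is \<open>CARD('n)\<close>. A chart is a pair of its (open) domain and its
  coordinate map, which is only meaningful on the domain. Tensor fields are families of coordinate
  expressions, one for each chart, indexed by points of the manifold, and related by the usual
  transformation rules.
\<close>

type_synonym ('m, 'n) chart = "'m set \<times> ('m \<Rightarrow> real ^ 'n)"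

abbreviation cinv :: "('m, 'n) chart \<Rightarrow> real ^ 'n \<Rightarrow> 'm" where
  "cinv \<kappa> \<equiv> inv_into (fst \<kappa>) (snd \<kappa>)"

definition is_chart :: "('m::topological_space, 'n::finite) chart \<Rightarrow> bool" where
  "is_chart \<kappa> \<longleftrightarrow> open (fst \<kappa>) \<and> open (snd \<kappa> ` fst \<kappa>) \<and>
     homeomorphism (fst \<kappa>) (snd \<kappa> ` fst \<kappa>) (snd \<kappa>) (cinv \<kappa>)"

definition partial_deriv ::
  "'n \<Rightarrow> (real ^ 'n::finite \<Rightarrow> 'b::real_normed_vector) \<Rightarrow> real ^ 'n \<Rightarrow> 'b" where
  "partial_deriv i F x = frechet_derivative F (at x) (axis i 1)"

text \<open>Used for open \<open>S\<close> only.\<close>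

primrec Ck_on :: "nat \<Rightarrow> (real ^ 'n::finite) set \<Rightarrow> (real ^ 'n \<Rightarrow> 'b::real_normed_vector) \<Rightarrow> bool" where
  "Ck_on 0 S F \<longleftrightarrow> continuous_on S F"
| "Ck_on (Suc k) S F \<longleftrightarrow> (\<forall>x\<in>S. F differentiable (at x)) \<and> (\<forall>i. Ck_on k S (partial_deriv i F))"

definition smooth_on :: "(real ^ 'n::finite) set \<Rightarrow> (real ^ 'n \<Rightarrow> 'b::real_normed_vector) \<Rightarrow> bool" where
  "smooth_on S F \<longleftrightarrow> (\<forall>k. Ck_on k S F)"

text \<open>Coordinate change from \<open>\<kappa>\<close> to \<open>\<kappa>'\<close>, and its Jacobian matrix at the point \<open>p\<close>.\<close>

definition transition ::
  "('m, 'n::finite) chart \<Rightarrow> ('m, 'n) chart \<Rightarrow> real ^ 'n \<Rightarrow> real ^ 'n" where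
  "transition \<kappa> \<kappa>' = snd \<kappa>' \<circ> cinv \<kappa>"

definition jacobian :: "('m, 'n::finite) chart \<Rightarrow> ('m, 'n) chart \<Rightarrow> 'm \<Rightarrow> real ^ 'n ^ 'n" where
  "jacobian \<kappa> \<kappa>' p = matrix (frechet_derivative (transition \<kappa> \<kappa>') (at (snd \<kappa> p)))"


section \<open>Square integrable functions\<close>

text \<open>Elements of \<open>L\<^sup>2\<close> are represented by functions: equality is almost everywhere equality.\<close>

definition L2 :: "'a measure \<Rightarrow> ('a \<Rightarrow> complex) set" where
  "L2 M = {y \<in> borel_measurable M. integrable M (\<lambda>x. (cmod (y x))\<^sup>2)}"

definition L2_converges :: "'a measure \<Rightarrow> (nat \<Rightarrow> 'a \<Rightarrow> complex) \<Rightarrow> ('a \<Rightarrow> complex) \<Rightarrow> bool" where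
  "L2_converges M u y \<longleftrightarrow> (\<forall>k. u k \<in> L2 M) \<and> y \<in> L2 M \<and>
     (\<lambda>k. \<integral>\<^sup>+x. ennreal ((cmod (u k x - y x))\<^sup>2) \<partial>M) \<longlonglongrightarrow> 0"

text \<open>The sum of a series converging in \<open>L\<^sup>2\<close> (determined up to null sets).\<close>

definition L2_suminf :: "'a measure \<Rightarrow> (nat \<Rightarrow> 'a \<Rightarrow> complex) \<Rightarrow> 'a \<Rightarrow> complex" where
  "L2_suminf M f = (SOME y. L2_converges M (\<lambda>N x. \<Sum>j<N. f j x) y)"


section \<open>Riemannian manifolds\<close>

text \<open>The measure \<open>V\<close> is the Riemannian volume on Borel sets; it is determined by its values in charts.\<close>

locale riemannian_manifold =
  fixes charts :: "('m::{t2_space, second_countable_topology}, 'n::finite) chart set"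
    and g :: "('m, 'n) chart \<Rightarrow> 'm \<Rightarrow> real ^ 'n ^ 'n"
    and V :: "'m measure"
  assumes charts: "\<And>\<kappa>. \<kappa> \<in> charts \<Longrightarrow> is_chart \<kappa>"
    and charts_cover: "(\<Union>\<kappa>\<in>charts. fst \<kappa>) = UNIV"
    and smooth_transition: "\<And>\<kappa> \<kappa>'. \<kappa> \<in> charts \<Longrightarrow> \<kappa>' \<in> charts \<Longrightarrow>
      smooth_on (snd \<kappa> ` (fst \<kappa> \<inter> fst \<kappa>')) (transition \<kappa> \<kappa>')"
    and metric_symmetric: "\<And>\<kappa> p. \<kappa> \<in> charts \<Longrightarrow> p \<in> fst \<kappa> \<Longrightarrow> transpose (g \<kappa> p) = g \<kappa> p"
    and metric_positive: "\<And>\<kappa> p v. \<kappa> \<in> charts \<Longrightarrow> p \<in> fst \<kappa> \<Longrightarrow> v \<noteq> 0 \<Longrightarrow> v \<bullet> (g \<kappa> p *v v) > 0"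
    and metric_smooth: "\<And>\<kappa> i j. \<kappa> \<in> charts \<Longrightarrow>
      smooth_on (snd \<kappa> ` fst \<kappa>) (\<lambda>x. g \<kappa> (cinv \<kappa> x) $ i $ j)"
    and metric_transform: "\<And>\<kappa> \<kappa>' p. \<kappa> \<in> charts \<Longrightarrow> \<kappa>' \<in> charts \<Longrightarrow> p \<in> fst \<kappa> \<inter> fst \<kappa>' \<Longrightarrow>
      g \<kappa> p = transpose (jacobian \<kappa> \<kappa>' p) ** g \<kappa>' p ** jacobian \<kappa> \<kappa>' p"
    and sets_volume: "sets V = sets borel"
    and volume_in_chart: "\<And>\<kappa> E. \<kappa> \<in> charts \<Longrightarrow> E \<in> sets borel \<Longrightarrow> E \<subseteq> fst \<kappa> \<Longrightarrow>
      emeasure V E = (\<integral>\<^sup>+x \<in> snd \<kappa> ` E. ennreal (sqrt (det (g \<kappa> (cinv \<kappa> x)))) \<partial>lborel)"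
begin

text \<open>
  Pointwise geometric quantities are evaluated in an arbitrary chart around the point. Their values
  do not depend on that choice, by the transformation rules.
\<close>

definition chart_at :: "'m \<Rightarrow> ('m, 'n) chart" where
  "chart_at p = (SOME \<kappa>. \<kappa> \<in> charts \<and> p \<in> fst \<kappa>)"

subsection \<open>Riemannian distance and Hausdorff measure\<close>

definition piecewise_C1_curve :: "(real \<Rightarrow> 'm) \<Rightarrow> bool" where
  "piecewise_C1_curve \<gamma> \<longleftrightarrow> continuous_on {0..1} \<gamma> \<and>
     (\<forall>\<kappa>\<in>charts. \<forall>a b. 0 \<le> a \<and> b \<le> 1 \<and> \<gamma> ` {a..b} \<subseteq> fst \<kappa> \<longrightarrow>
        (snd \<kappa> \<circ> \<gamma>) piecewise_C1_differentiable_on {a..b})"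

definition speed :: "(real \<Rightarrow> 'm) \<Rightarrow> real \<Rightarrow> real" where
  "speed \<gamma> t = (let \<kappa> = chart_at (\<gamma> t); v = vector_derivative (snd \<kappa> \<circ> \<gamma>) (at t)
     in sqrt (v \<bullet> (g \<kappa> (\<gamma> t) *v v)))"

definition curve_length :: "(real \<Rightarrow> 'm) \<Rightarrow> ennreal" where
  "curve_length \<gamma> = (\<integral>\<^sup>+t\<in>{0..1}. ennreal (speed \<gamma> t) \<partial>lborel)"

text \<open>The distance is infinite between points of different connected components.\<close>

definition rdist :: "'m \<Rightarrow> 'm \<Rightarrow> ennreal" where
  "rdist p q = (INF \<gamma>\<in>{\<gamma>. piecewise_C1_curve \<gamma> \<and> \<gamma> 0 = p \<and> \<gamma> 1 = q}. curve_length \<gamma>)"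

definition rdiam :: "'m set \<Rightarrow> ennreal" where
  "rdiam C = (SUP p\<in>C. SUP q\<in>C. rdist p q)"

definition rbounded :: "'m set \<Rightarrow> bool" where
  "rbounded S \<longleftrightarrow> rdiam S < \<infinity>"

text \<open>
  The surface measure on boundaries is the Hausdorff measure of dimension \<open>CARD('n) - 1\<close>,
  normalised to coincide with the induced Riemannian measure on smooth hypersurfaces
  (for \<open>CARD('n) = 1\<close> this is counting measure).
\<close>

definition hausdorff_weight :: "'m set \<Rightarrow> ennreal" where
  "hausdorff_weight C = (if C = {} then 0
     else ennreal (unit_ball_vol (real (CARD('n) - 1))) * (rdiam C / 2) ^ (CARD('n) - 1))"

definition hausdorff_outer :: "'m set \<Rightarrow> ennreal" where
  "hausdorff_outer E = (SUP \<delta>\<in>{0<..}.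
     INF C\<in>{C :: nat \<Rightarrow> 'm set. E \<subseteq> (\<Union>k. C k) \<and> (\<forall>k. rdiam (C k) \<le> \<delta>)}.
       \<Sum>k. hausdorff_weight (C k))"

definition surface_measure :: "'m set \<Rightarrow> 'm measure" where
  "surface_measure \<Gamma> =
     restrict_space (completion (measure_of UNIV (sets borel) hausdorff_outer)) \<Gamma>"

subsection \<open>The Laplace--Beltrami operator and Sobolev functions\<close>

definition volume_on :: "'m set \<Rightarrow> 'm measure" where
  "volume_on S = restrict_space (completion V) S"

definition test_function :: "'m set \<Rightarrow> ('m \<Rightarrow> real) \<Rightarrow> bool" where
  "test_function S \<psi> \<longleftrightarrow> (\<forall>\<kappa>\<in>charts. smooth_on (snd \<kappa> ` fst \<kappa>) (\<psi> \<circ> cinv \<kappa>)) \<and>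
     (\<exists>K. compact K \<and> K \<subseteq> S \<and> (\<forall>p. p \<notin> K \<longrightarrow> \<psi> p = 0))"

definition laplace_beltrami :: "('m \<Rightarrow> real) \<Rightarrow> 'm \<Rightarrow> real" where
  "laplace_beltrami \<psi> p =
     (let \<kappa> = chart_at p; G = (\<lambda>x. g \<kappa> (cinv \<kappa> x)); s = (\<lambda>x. sqrt (det (G x))); x = snd \<kappa> p
      in (\<Sum>i\<in>UNIV. partial_deriv i
            (\<lambda>z. s z * (\<Sum>j\<in>UNIV. matrix_inv (G z) $ i $ j * partial_deriv j (\<psi> \<circ> cinv \<kappa>) z)) x) / s x)"

text \<open>\<open>\<Delta>y = h\<close> on the open set \<open>\<Omega>\<close> in the sense of distributions.\<close>

definition weak_laplacian :: "'m set \<Rightarrow> ('m \<Rightarrow> complex) \<Rightarrow> ('m \<Rightarrow> complex) \<Rightarrow> bool" where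
  "weak_laplacian \<Omega> y h \<longleftrightarrow> (\<forall>\<psi>. test_function \<Omega> \<psi> \<longrightarrow>
     (\<integral>p. y p * complex_of_real (laplace_beltrami \<psi> p) \<partial>volume_on \<Omega>) =
     (\<integral>p. h p * complex_of_real (\<psi> p) \<partial>volume_on \<Omega>))"

text \<open>Complex covector fields on \<open>\<Omega>\<close>, measurable with respect to the volume.\<close>

definition covector_field :: "'m set \<Rightarrow> (('m, 'n) chart \<Rightarrow> 'm \<Rightarrow> complex ^ 'n) \<Rightarrow> bool" where
  "covector_field \<Omega> w \<longleftrightarrow>
     (\<forall>\<kappa>\<in>charts. \<forall>i. (\<lambda>p. w \<kappa> p $ i) \<in> borel_measurable (volume_on (fst \<kappa> \<inter> \<Omega>))) \<and>
     (\<forall>\<kappa>\<in>charts. \<forall>\<kappa>'\<in>charts. \<forall>p \<in> fst \<kappa> \<inter> fst \<kappa>' \<inter> \<Omega>. \<forall>i.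
        w \<kappa> p $ i = (\<Sum>k\<in>UNIV. complex_of_real (jacobian \<kappa> \<kappa>' p $ k $ i) * w \<kappa>' p $ k))"

definition covector_inner ::
  "(('m, 'n) chart \<Rightarrow> 'm \<Rightarrow> complex ^ 'n) \<Rightarrow> (('m, 'n) chart \<Rightarrow> 'm \<Rightarrow> complex ^ 'n) \<Rightarrow> 'm \<Rightarrow> complex" where
  "covector_inner w z p = (let \<kappa> = chart_at p in
     \<Sum>i\<in>UNIV. \<Sum>j\<in>UNIV. complex_of_real (matrix_inv (g \<kappa> p) $ i $ j) * w \<kappa> p $ i * cnj (z \<kappa> p $ j))"

text \<open>\<open>y \<in> H\<^sup>1(\<Omega>)\<close>, with weak differential \<open>w\<close>.\<close>

definition sobolev_H1 ::
  "'m set \<Rightarrow> ('m \<Rightarrow> complex) \<Rightarrow> (('m, 'n) chart \<Rightarrow> 'm \<Rightarrow> complex ^ 'n) \<Rightarrow> bool" where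
  "sobolev_H1 \<Omega> y w \<longleftrightarrow> y \<in> L2 (volume_on \<Omega>) \<and> covector_field \<Omega> w \<and>
     integrable (volume_on \<Omega>) (covector_inner w w) \<and>
     (\<forall>\<kappa>\<in>charts. \<forall>i. \<forall>\<psi>. test_function (fst \<kappa> \<inter> \<Omega>) \<psi> \<longrightarrow>
        (LINT x:snd \<kappa> ` (fst \<kappa> \<inter> \<Omega>)|lebesgue.
            y (cinv \<kappa> x) * complex_of_real (partial_deriv i (\<psi> \<circ> cinv \<kappa>) x)) =
        - (LINT x:snd \<kappa> ` (fst \<kappa> \<inter> \<Omega>)|lebesgue.
            w \<kappa> (cinv \<kappa> x) $ i * complex_of_real (\<psi> (cinv \<kappa> x))))"

text \<open>
  The boundary trace: \<open>t \<in> L\<^sup>2(\<partial>\<Omega>)\<close> is the limit of the boundary values of functions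
  continuous on the closure that converge to \<open>y\<close> in \<open>H\<^sup>1(\<Omega>)\<close>.
\<close>

definition has_trace :: "'m set \<Rightarrow> ('m \<Rightarrow> complex) \<Rightarrow> ('m \<Rightarrow> complex) \<Rightarrow> bool" where
  "has_trace \<Omega> y t \<longleftrightarrow> (\<exists>w u du. sobolev_H1 \<Omega> y w \<and>
     (\<forall>k::nat. sobolev_H1 \<Omega> (u k) (du k) \<and> continuous_on (closure \<Omega>) (u k)) \<and>
     L2_converges (volume_on \<Omega>) u y \<and>
     (\<lambda>k. \<integral>\<^sup>+p. ennreal (Re (covector_inner (\<lambda>\<kappa> q. du k \<kappa> q - w \<kappa> q) (\<lambda>\<kappa> q. du k \<kappa> q - w \<kappa> q) p))
         \<partial>volume_on \<Omega>) \<longlonglongrightarrow> 0 \<and>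
     L2_converges (surface_measure (frontier \<Omega>)) u t)"

text \<open>
  The outward normal derivative of \<open>y\<close> is the functional on the boundary values of \<open>v\<close> given by
  Green's formula: for smooth data \<open>green_form \<Omega> w h v z\<close>, with \<open>w = dy\<close>, \<open>h = \<Delta>y\<close> and \<open>z = dv\<close>,
  is the integral over \<open>\<partial>\<Omega>\<close> of the normal derivative of \<open>y\<close> times the conjugate of \<open>v\<close>.
\<close>

definition green_form ::
  "'m set \<Rightarrow> (('m, 'n) chart \<Rightarrow> 'm \<Rightarrow> complex ^ 'n) \<Rightarrow> ('m \<Rightarrow> complex) \<Rightarrow>
   ('m \<Rightarrow> complex) \<Rightarrow> (('m, 'n) chart \<Rightarrow> 'm \<Rightarrow> complex ^ 'n) \<Rightarrow> complex" where
  "green_form \<Omega> w h v z =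
     (\<integral>p. covector_inner w z p \<partial>volume_on \<Omega>) + (\<integral>p. h p * cnj (v p) \<partial>volume_on \<Omega>)"

end


section \<open>Boundary conditions and the operator \<open>A\<close>\<close>

datatype 'm boundary_condition =
    No_Boundary
  | Dirichlet
  | Neumann
  | Mixed "'m set" "'m set"
  | Robin "'m \<Rightarrow> real"

context riemannian_manifold
begin

definition admissible :: "'m set \<Rightarrow> 'm boundary_condition \<Rightarrow> bool" where
  "admissible \<Omega> bc \<longleftrightarrow>
     (case bc of
        No_Boundary \<Rightarrow> frontier \<Omega> = {} \<and> compact \<Omega>
      | Dirichlet \<Rightarrow> frontier \<Omega> \<noteq> {}
      | Neumann \<Rightarrow> frontier \<Omega> \<noteq> {}
      | Mixed \<Gamma>0 \<Gamma>1 \<Rightarrow> frontier \<Omega> \<noteq> {} \<and> frontier \<Omega> = \<Gamma>0 \<union> \<Gamma>1 \<and> \<Gamma>0 \<inter> \<Gamma>1 = {}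
      | Robin \<beta> \<Rightarrow> frontier \<Omega> \<noteq> {} \<and>
          \<beta> \<in> borel_measurable (surface_measure (frontier \<Omega>)) \<and>
          (\<forall>p\<in>frontier \<Omega>. \<beta> p \<ge> 0) \<and> (\<exists>B. \<forall>p\<in>frontier \<Omega>. \<beta> p \<le> B) \<and>
          (\<integral>\<^sup>+p. ennreal (\<beta> p) \<partial>surface_measure (frontier \<Omega>)) > 0)"

text \<open>\<open>By = 0\<close>, for \<open>y\<close> with \<open>\<Delta>y = h\<close>.\<close>

definition satisfies_bc :: "'m set \<Rightarrow> 'm boundary_condition \<Rightarrow> ('m \<Rightarrow> complex) \<Rightarrow> ('m \<Rightarrow> complex) \<Rightarrow> bool" where
  "satisfies_bc \<Omega> bc y h \<longleftrightarrow>
     (case bc of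
        No_Boundary \<Rightarrow> True
      | Dirichlet \<Rightarrow> has_trace \<Omega> y (\<lambda>_. 0)
      | Neumann \<Rightarrow> (\<exists>w. sobolev_H1 \<Omega> y w \<and>
          (\<forall>v z. sobolev_H1 \<Omega> v z \<longrightarrow> green_form \<Omega> w h v z = 0))
      | Mixed \<Gamma>0 \<Gamma>1 \<Rightarrow> (\<exists>w t. sobolev_H1 \<Omega> y w \<and> has_trace \<Omega> y t \<and>
          (AE p in surface_measure (frontier \<Omega>). p \<in> \<Gamma>0 \<longrightarrow> t p = 0) \<and>
          (\<forall>v z s. sobolev_H1 \<Omega> v z \<and> has_trace \<Omega> v s \<and>
              (AE p in surface_measure (frontier \<Omega>). p \<in> \<Gamma>0 \<longrightarrow> s p = 0) \<longrightarrow>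
            green_form \<Omega> w h v z = 0))
      | Robin \<beta> \<Rightarrow> (\<exists>w t. sobolev_H1 \<Omega> y w \<and> has_trace \<Omega> y t \<and>
          (\<forall>v z s. sobolev_H1 \<Omega> v z \<and> has_trace \<Omega> v s \<longrightarrow>
            green_form \<Omega> w h v z +
            (\<integral>p. complex_of_real (\<beta> p) * t p * cnj (s p) \<partial>surface_measure (frontier \<Omega>)) = 0)))"

definition state_space :: "'m set \<Rightarrow> 'm boundary_condition \<Rightarrow> ('m \<Rightarrow> complex) set" where
  "state_space \<Omega> bc = {y \<in> L2 (volume_on \<Omega>).
     bc = No_Boundary \<or> bc = Neumann \<longrightarrow> (\<integral>p. y p \<partial>volume_on \<Omega>) = 0}"

text \<open>The graph of \<open>A = -\<Delta>\<close>; its projection to the first component is the domain of \<open>A\<close>.\<close>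

definition operator_A :: "'m set \<Rightarrow> 'm boundary_condition \<Rightarrow> (('m \<Rightarrow> complex) \<times> ('m \<Rightarrow> complex)) set" where
  "operator_A \<Omega> bc = {(y, f). y \<in> state_space \<Omega> bc \<and> f \<in> state_space \<Omega> bc \<and>
     weak_laplacian \<Omega> y (\<lambda>p. - f p) \<and> satisfies_bc \<Omega> bc y (\<lambda>p. - f p)}"

end

locale bounded_domain = riemannian_manifold charts g V
  for charts :: "('m::{t2_space, second_countable_topology}, 'n::finite) chart set"
    and g :: "('m, 'n) chart \<Rightarrow> 'm \<Rightarrow> real ^ 'n ^ 'n"
    and V :: "'m measure" +
  fixes \<Omega> :: "'m set" and bc :: "'m boundary_condition"
  assumes open_domain: "open \<Omega>"
    and connected_domain: "connected \<Omega>"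
    and bounded_domain: "rbounded \<Omega>"
    and admissible_bc: "admissible \<Omega> bc"

text \<open>
  A Hilbert basis of the state space (orthonormal, with dense linear span) made of real-valued
  eigenfunctions of \<open>A\<close>, indexed from \<open>0\<close>; the eigenvalue of \<open>\<phi> j\<close> is \<open>(lam j)\<^sup>2\<close>.
\<close>

locale spectral_setting = bounded_domain charts g V \<Omega> bc
  for charts :: "('m::{t2_space, second_countable_topology}, 'n::finite) chart set"
    and g :: "('m, 'n) chart \<Rightarrow> 'm \<Rightarrow> real ^ 'n ^ 'n"
    and V :: "'m measure" and \<Omega> :: "'m set" and bc :: "'m boundary_condition" +
  fixes \<phi> :: "nat \<Rightarrow> 'm \<Rightarrow> real" and lam :: "nat \<Rightarrow> real"
  assumes lam_pos: "\<And>j. lam j > 0"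
    and eigenfunction: "\<And>j. (\<lambda>p. complex_of_real (\<phi> j p),
          \<lambda>p. complex_of_real ((lam j)\<^sup>2 * \<phi> j p)) \<in> operator_A \<Omega> bc"
    and orthonormal: "\<And>j k. (\<integral>p. \<phi> j p * \<phi> k p \<partial>volume_on \<Omega>) = (if j = k then 1 else 0)"
    and span_dense: "\<And>y \<epsilon>. y \<in> state_space \<Omega> bc \<Longrightarrow> \<epsilon> > 0 \<Longrightarrow>
          \<exists>N (c :: nat \<Rightarrow> complex).
            (\<integral>\<^sup>+p. ennreal ((cmod (y p - (\<Sum>j<N. c j * complex_of_real (\<phi> j p))))\<^sup>2) \<partial>volume_on \<Omega>) < \<epsilon>"


section \<open>Randomized observability constants\<close>

definition bernoulli_sign :: "'p measure \<Rightarrow> ('p \<Rightarrow> real) \<Rightarrow> bool" where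
  "bernoulli_sign P X \<longleftrightarrow> X \<in> borel_measurable P \<and>
     measure P {\<nu> \<in> space P. X \<nu> = 1} = 1 / 2 \<and> measure P {\<nu> \<in> space P. X \<nu> = - 1} = 1 / 2"

definition independent_signs :: "'p measure \<Rightarrow> (nat \<Rightarrow> 'p \<Rightarrow> real) \<Rightarrow> bool" where
  "independent_signs P X \<longleftrightarrow> (\<forall>j. bernoulli_sign P (X j)) \<and>
     prob_space.indep_vars P (\<lambda>_. borel) X UNIV"

definition ell2 :: "(nat \<Rightarrow> complex) set" where
  "ell2 = {u. summable (\<lambda>j. (cmod (u j))\<^sup>2)}"

text \<open>
  The parameter \<open>M\<close> is the volume measure on \<open>\<Omega>\<close>. For fixed \<open>\<nu>\<close> and \<open>t\<close> the series converge in
  \<open>L\<^sup>2(M)\<close>. All integrands are nonnegative, so the expectations and integrals, and hence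
  the constants, are taken in \<open>[0,\<infinity>]\<close>.
\<close>

definition C_rand_wave ::
  "'m measure \<Rightarrow> (nat \<Rightarrow> 'm \<Rightarrow> real) \<Rightarrow> (nat \<Rightarrow> real) \<Rightarrow> 'p measure \<Rightarrow>
   (nat \<Rightarrow> 'p \<Rightarrow> real) \<Rightarrow> (nat \<Rightarrow> 'p \<Rightarrow> real) \<Rightarrow> real \<Rightarrow> 'm set \<Rightarrow> ennreal" where
  "C_rand_wave M \<phi> lam P \<beta>1 \<beta>2 T \<omega> = 1 / 2 *
     (INF (a, b) \<in> {(a, b). (\<lambda>j. complex_of_real (lam j) * a j) \<in> ell2 \<and>
                            (\<lambda>j. complex_of_real (lam j) * b j) \<in> ell2 \<and>
                            (\<Sum>j. (lam j)\<^sup>2 * ((cmod (a j))\<^sup>2 + (cmod (b j))\<^sup>2)) = 1}.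
        \<integral>\<^sup>+\<nu>. (\<integral>\<^sup>+t\<in>{0..T}. (\<integral>\<^sup>+x\<in>\<omega>. ennreal ((cmod (L2_suminf M (\<lambda>j x.
             complex_of_real (lam j) *
             (complex_of_real (\<beta>1 j \<nu>) * a j * exp (\<i> * complex_of_real (lam j * t)) -
              complex_of_real (\<beta>2 j \<nu>) * b j * exp (- \<i> * complex_of_real (lam j * t))) *
             complex_of_real (\<phi> j x)) x))\<^sup>2) \<partial>M) \<partial>lborel) \<partial>P)"

definition C_rand_schroedinger ::
  "'m measure \<Rightarrow> (nat \<Rightarrow> 'm \<Rightarrow> real) \<Rightarrow> (nat \<Rightarrow> real) \<Rightarrow> 'p measure \<Rightarrow>
   (nat \<Rightarrow> 'p \<Rightarrow> real) \<Rightarrow> real \<Rightarrow> 'm set \<Rightarrow> ennreal" where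
  "C_rand_schroedinger M \<phi> lam P \<beta> T \<omega> =
     (INF c \<in> {c. (\<lambda>j. complex_of_real ((lam j)\<^sup>2) * c j) \<in> ell2 \<and>
                  (\<Sum>j. (lam j) ^ 4 * (cmod (c j))\<^sup>2) = 1}.
        \<integral>\<^sup>+\<nu>. (\<integral>\<^sup>+t\<in>{0..T}. (\<integral>\<^sup>+x\<in>\<omega>. ennreal ((cmod (L2_suminf M (\<lambda>j x.
             complex_of_real ((lam j)\<^sup>2) *
             (complex_of_real (\<beta> j \<nu>) * c j * exp (\<i> * complex_of_real ((lam j)\<^sup>2 * t))) *
             complex_of_real (\<phi> j x)) x))\<^sup>2) \<partial>M) \<partial>lborel) \<partial>P)"

definition J_functional :: "'m measure \<Rightarrow> (nat \<Rightarrow> 'm \<Rightarrow> real) \<Rightarrow> 'm set \<Rightarrow> ennreal" where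
  "J_functional M \<phi> \<omega> = (INF j. \<integral>\<^sup>+x\<in>\<omega>. ennreal ((\<phi> j x)\<^sup>2) \<partial>M)"

end

theory Submission
  imports Defs
begin

text \<open>
  Both quantities under the infimum are computed exactly. Put \<open>g\<^sub>j = \<integral>\<^sub>\<omega> \<phi>\<^sub>j\<^sup>2\<close>. For a random
  series \<open>\<Sum> Z\<^sub>j(\<nu>,t) \<phi>\<^sub>j\<close>, expanding the square over \<open>\<omega>\<close> gives a quadratic form in the \<open>Z\<^sub>j\<close> whose
  coefficients are the integrals of \<open>\<phi>\<^sub>j \<phi>\<^sub>k\<close> over \<open>\<omega>\<close>. The random signs make
  \<open>Z\<^sub>j\<close> and \<open>Z\<^sub>k\<close> uncorrelated for \<open>j \<noteq> k\<close>, at every fixed time, so that only the diagonal survives the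
  expectation: the mean energy is \<open>T \<Sum> r\<^sub>j g\<^sub>j\<close> with \<open>r\<^sub>j = \<lambda>\<^sub>j\<^sup>2 (|a\<^sub>j|\<^sup>2 + |b\<^sub>j|\<^sup>2)\<close> for waves and
  \<open>r\<^sub>j = \<lambda>\<^sub>j\<^sup>4 |c\<^sub>j|\<^sup>2\<close> for the Schroedinger equation. The normalisation says \<open>\<Sum> r\<^sub>j = 1\<close>, hence both
  constants are, up to the factor \<open>T\<close> (and \<open>1/2\<close> for waves), the infimum of all weighted averages of
  the \<open>g\<^sub>j\<close>. It equals the infimum of the \<open>g\<^sub>j\<close>, which is approached by concentrating the weight on a single mode
  (\<open>Inf_weighted_averages\<close>).

  The analytic content is \<open>expected_energy\<close>, which justifies exchanging the series with the
  integrals. The sum of the series is only chosen up to a null set, separately for each \<open>(\<nu>,t)\<close>, so nothing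
  is known about its measurability in \<open>(\<nu>,t)\<close>. Its energy on \<open>\<omega>\<close>, however, does not depend
  on the choice: it is the limit of the energies of the partial sums
  (\<open>L2_converges_set_norm\<close>), and these are quadratic polynomials in the jointly measurable \<open>Z\<^sub>j\<close>. That
  the series converges at all is the theorem of Riesz and Fischer, from the completeness of
  \<open>L\<^sup>2\<close> (\<open>L2_complete\<close>).

  The link with the manifold is \<open>real_orthonormal_system_basis\<close>: the eigenfunctions lie in the state space, hence
  are square integrable on \<open>\<Omega>\<close>, so that the above applies to them.
\<close>

section \<open>Completeness of the space of square integrable functions\<close>

lemma power2_add_le: "((a::real) + b)\<^sup>2 \<le> 2 * a\<^sup>2 + 2 * b\<^sup>2"
  using sum_squares_bound[of a b] by (simp add: power2_sum)

lemma cmod_diff_power2_le: "(cmod (x - y))\<^sup>2 \<le> 2 * (cmod x)\<^sup>2 + 2 * (cmod y)\<^sup>2"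
proof -
  have "(cmod (x - y))\<^sup>2 \<le> (cmod x + cmod y)\<^sup>2"
    by (intro power_mono norm_triangle_ineq4) simp
  with power2_add_le[of "cmod x" "cmod y"] show ?thesis by linarith
qed

lemma L2_measurable: "y \<in> L2 M \<Longrightarrow> y \<in> borel_measurable M"
  by (simp add: L2_def)

lemma L2_diff:
  assumes "x \<in> L2 M" "y \<in> L2 M"
  shows "(\<lambda>p. x p - y p) \<in> L2 M"
proof -
  note [measurable] = L2_measurable[OF assms(1)] L2_measurable[OF assms(2)]
  have "integrable M (\<lambda>p. 2 * (cmod (x p))\<^sup>2 + 2 * (cmod (y p))\<^sup>2)"
    using assms by (auto simp: L2_def)
  then have "integrable M (\<lambda>p. (cmod (x p - y p))\<^sup>2)"
    by (rule Bochner_Integration.integrable_bound) (auto simp: cmod_diff_power2_le intro!: AE_I2)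
  then show ?thesis by (simp add: L2_def)
qed

lemma L2_nn_integral_iff:
  "y \<in> L2 M \<longleftrightarrow> y \<in> borel_measurable M \<and> (\<integral>\<^sup>+p. ennreal ((cmod (y p))\<^sup>2) \<partial>M) < \<infinity>"
  by (auto simp: L2_def integrable_iff_bounded)

text \<open>
  A subsequence whose consecutive differences \<open>d\<^sub>k\<close> satisfy \<open>\<integral> d\<^sub>k\<^sup>2 \<le> 4\<^sup>-\<^sup>k\<close> converges almost everywhere.
  Indeed \<open>\<Sum> 2\<^sup>k d\<^sub>k\<^sup>2\<close> has finite integral, hence is finite almost everywhere, and
  \<open>2 d\<^sub>k \<le> 2\<^sup>-\<^sup>k + 2\<^sup>k d\<^sub>k\<^sup>2\<close> turns this into summability of the \<open>d\<^sub>k\<close> without Minkowski's inequality for series.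
  Fatou's lemma then shows that the whole sequence converges in \<open>L\<^sup>2\<close> to the pointwise limit.
\<close>

lemma L2_complete:
  assumes u: "\<And>k. u k \<in> L2 M"
    and Cauchy: "\<And>e. e > 0 \<Longrightarrow> \<exists>N. \<forall>m\<ge>N. \<forall>n\<ge>N. (\<integral>\<^sup>+p. ennreal ((cmod (u m p - u n p))\<^sup>2) \<partial>M) \<le> ennreal e"
  shows "\<exists>y. L2_converges M u y"
proof -
  note [measurable] = L2_measurable[OF u]
  have "\<forall>k. \<exists>N. \<forall>m\<ge>N. \<forall>n\<ge>N. (\<integral>\<^sup>+p. ennreal ((cmod (u m p - u n p))\<^sup>2) \<partial>M) \<le> ennreal ((1/4)^k)"
    using Cauchy by simp
  then obtain N where N: "\<And>k m n. m \<ge> N k \<Longrightarrow> n \<ge> N k \<Longrightarrow>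
      (\<integral>\<^sup>+p. ennreal ((cmod (u m p - u n p))\<^sup>2) \<partial>M) \<le> ennreal ((1/4)^k)"
    by metis
  \<comment> \<open>The sum makes \<open>s k\<close> dominate all \<open>N i\<close> with \<open>i \<le> k\<close>; adding \<open>k\<close> makes them unbounded.\<close>
  define s where "s k = (\<Sum>i\<le>k. N i) + k" for k
  have s_ge: "s k \<ge> N k" "s k \<ge> k" for k
    using member_le_sum[of k "{..k}" N] by (auto simp: s_def)
  have s_Suc: "s (Suc k) \<ge> N k" for k
    using s_ge(1)[of k] by (simp add: s_def)
  define d where "d k p = cmod (u (s (Suc k)) p - u (s k) p)" for k p
  have d_measurable [measurable]: "d k \<in> borel_measurable M" for k
    by (simp add: d_def[abs_def])
  have "(\<integral>\<^sup>+p. (\<Sum>k. ennreal (2^k * (d k p)\<^sup>2)) \<partial>M) = (\<Sum>k. \<integral>\<^sup>+p. ennreal (2^k * (d k p)\<^sup>2) \<partial>M)"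
    by (intro nn_integral_suminf) simp
  also have "\<dots> \<le> (\<Sum>k. ennreal ((1/2)^k))"
  proof (intro suminf_le summableI)
    fix k
    have "(\<integral>\<^sup>+p. ennreal (2^k * (d k p)\<^sup>2) \<partial>M) = ennreal (2^k) * (\<integral>\<^sup>+p. ennreal ((d k p)\<^sup>2) \<partial>M)"
      by (simp add: ennreal_mult nn_integral_cmult)
    also have "\<dots> \<le> ennreal (2^k) * ennreal ((1/4)^k)"
      unfolding d_def by (intro mult_left_mono N s_Suc s_ge) simp
    also have "\<dots> = ennreal (2^k * (1/4)^k)"
      by (simp add: ennreal_mult)
    also have "(2::real)^k * (1/4)^k = (1/2)^k"
      by (simp flip: power_mult_distrib)
    finally show "(\<integral>\<^sup>+p. ennreal (2^k * (d k p)\<^sup>2) \<partial>M) \<le> ennreal ((1/2)^k)" .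
  qed
  also have "\<dots> < \<infinity>"
    by (subst suminf_ennreal2) (auto intro: summable_geometric)
  finally have fin: "AE p in M. (\<Sum>k. ennreal (2^k * (d k p)\<^sup>2)) \<noteq> \<infinity>"
    by (intro nn_integral_PInf_AE) auto
  define y where "y p = lim (\<lambda>k. u (s k) p)" for p
  have y_measurable [measurable]: "y \<in> borel_measurable M"
    by (simp add: y_def[abs_def])
  from fin have lim: "AE p in M. (\<lambda>k. u (s k) p) \<longlonglongrightarrow> y p"
  proof eventually_elim
    case (elim p)
    have sum_sq: "summable (\<lambda>k. 2^k * (d k p)\<^sup>2)"
      by (rule summable_suminf_not_top) (use elim in auto)
    have "summable (\<lambda>k. d k p)"
    proof (rule summable_comparison_test')
      show "summable (\<lambda>k. (1/2)^k + 2^k * (d k p)\<^sup>2)"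
        by (intro summable_add sum_sq summable_geometric) simp
      fix k :: nat
      have "0 \<le> (1 - 2^k * d k p)\<^sup>2" by simp
      then have "2 * (2^k * d k p) \<le> 1 + 2^k * (2^k * (d k p)\<^sup>2)"
        by (simp add: power2_diff power_mult_distrib power2_eq_square algebra_simps)
      then have "2 * d k p \<le> (1 + 2^k * (2^k * (d k p)\<^sup>2)) / 2^k"
        by (simp add: field_simps)
      also have "\<dots> = (1/2)^k + 2^k * (d k p)\<^sup>2"
        by (simp add: field_simps)
      finally have "2 * d k p \<le> (1/2)^k + 2^k * (d k p)\<^sup>2" .
      moreover have "d k p \<ge> 0" by (simp add: d_def)
      ultimately show "norm (d k p) \<le> (1/2)^k + 2^k * (d k p)\<^sup>2" by simp
    qed
    then have "summable (\<lambda>k. u (s (Suc k)) p - u (s k) p)"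
      unfolding d_def by (auto intro: summable_norm_cancel)
    then have "convergent (\<lambda>n. (\<Sum>k<n. u (s (Suc k)) p - u (s k) p) + u (s 0) p)"
      by (simp add: summable_iff_convergent convergent_add_const_right_iff)
    moreover have "(\<Sum>k<n. u (s (Suc k)) p - u (s k) p) + u (s 0) p = u (s n) p" for n
      using sum_lessThan_telescope[of "\<lambda>k. u (s k) p" n] by simp
    ultimately have "convergent (\<lambda>k. u (s k) p)" by simp
    then show ?case
      by (simp add: y_def convergent_LIMSEQ_iff)
  qed
  have bound: "(\<integral>\<^sup>+p. ennreal ((cmod (u m p - y p))\<^sup>2) \<partial>M) \<le> ennreal e"
    if "\<And>n. n \<ge> K \<Longrightarrow> (\<integral>\<^sup>+p. ennreal ((cmod (u m p - u n p))\<^sup>2) \<partial>M) \<le> ennreal e" for m K e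
  proof -
    have "(\<integral>\<^sup>+p. ennreal ((cmod (u m p - y p))\<^sup>2) \<partial>M) =
        (\<integral>\<^sup>+p. liminf (\<lambda>k. ennreal ((cmod (u m p - u (s k) p))\<^sup>2)) \<partial>M)"
    proof (rule nn_integral_cong_AE, use lim in eventually_elim)
      case (elim p)
      then have "(\<lambda>k. ennreal ((cmod (u m p - u (s k) p))\<^sup>2)) \<longlonglongrightarrow> ennreal ((cmod (u m p - y p))\<^sup>2)"
        by (intro tendsto_intros)
      from lim_imp_Liminf[OF trivial_limit_sequentially this] show ?case by (rule sym)
    qed
    also have "\<dots> \<le> liminf (\<lambda>k. \<integral>\<^sup>+p. ennreal ((cmod (u m p - u (s k) p))\<^sup>2) \<partial>M)"
      by (intro nn_integral_liminf) simp
    also have "\<dots> \<le> ennreal e"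
    proof (rule Liminf_le[OF trivial_limit_sequentially])
      show "\<forall>\<^sub>F k in sequentially. (\<integral>\<^sup>+p. ennreal ((cmod (u m p - u (s k) p))\<^sup>2) \<partial>M) \<le> ennreal e"
        using that s_ge(2) by (intro eventually_sequentiallyI[of K]) (meson le_trans)
    qed
    finally show ?thesis .
  qed
  have conv: "(\<lambda>k. \<integral>\<^sup>+p. ennreal ((cmod (u k p - y p))\<^sup>2) \<partial>M) \<longlonglongrightarrow> 0"
  proof (rule order_tendstoI)
    fix a :: ennreal assume "0 < a"
    then obtain b where b: "0 < b" "b < a" using dense by blast
    define e where "e = enn2real b"
    have "b < top" using b(2) by (rule less_le_trans) simp
    with b(1) have e: "ennreal e = b" "e > 0"
      by (simp_all add: e_def enn2real_positive_iff)
    obtain K where K: "\<And>m n. m \<ge> K \<Longrightarrow> n \<ge> K \<Longrightarrow> (\<integral>\<^sup>+p. ennreal ((cmod (u m p - u n p))\<^sup>2) \<partial>M) \<le> ennreal e"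
      using Cauchy[OF e(2)] by blast
    have le: "(\<integral>\<^sup>+p. ennreal ((cmod (u m p - y p))\<^sup>2) \<partial>M) \<le> ennreal e" if "m \<ge> K" for m
      by (rule bound) (rule K[OF that])
    have "(\<integral>\<^sup>+p. ennreal ((cmod (u m p - y p))\<^sup>2) \<partial>M) < a" if "m \<ge> K" for m
      using le[OF that] b(2) unfolding e(1) by (rule le_less_trans)
    then show "\<forall>\<^sub>F m in sequentially. (\<integral>\<^sup>+p. ennreal ((cmod (u m p - y p))\<^sup>2) \<partial>M) < a"
      by (rule eventually_sequentiallyI)
  qed simp
  have "\<exists>k. (\<lambda>p. u k p - y p) \<in> L2 M"
  proof -
    have "\<forall>\<^sub>F k in sequentially. (\<integral>\<^sup>+p. ennreal ((cmod (u k p - y p))\<^sup>2) \<partial>M) < \<infinity>"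
      using conv by (rule order_tendstoD) simp
    then obtain k where "(\<integral>\<^sup>+p. ennreal ((cmod (u k p - y p))\<^sup>2) \<partial>M) < \<infinity>"
      by (auto simp: eventually_sequentially)
    then show ?thesis
      by (auto simp: L2_nn_integral_iff intro!: exI[of _ k])
  qed
  then obtain k where "(\<lambda>p. u k p - y p) \<in> L2 M" ..
  from L2_diff[OF u[of k] this] have "y \<in> L2 M" by simp
  with u conv show ?thesis
    by (auto simp: L2_converges_def)
qed

section \<open>Convergence of local energies\<close>

text \<open>
  Since \<open>|u|\<^sup>2 - |y|\<^sup>2\<close> is at most \<open>|u - y| (|u - y| + 2 |y|)\<close> in modulus, Young's inequality with a free parameter
  \<open>e\<close> bounds the difference of the energies by \<open>(1 + 1/e) \<integral>|u - y|\<^sup>2 + e \<integral>|y|\<^sup>2\<close>; the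
  second term is made small through \<open>e\<close>, then the first by convergence.
\<close>

lemma L2_converges_set_norm:
  assumes conv: "L2_converges M u y" and [measurable]: "\<omega> \<in> sets M"
  shows "(\<lambda>k. \<integral>\<^sup>+x\<in>\<omega>. ennreal ((cmod (u k x))\<^sup>2) \<partial>M) \<longlonglongrightarrow> (\<integral>\<^sup>+x\<in>\<omega>. ennreal ((cmod (y x))\<^sup>2) \<partial>M)"
proof -
  have u: "u k \<in> L2 M" and y: "y \<in> L2 M" for k
    using conv by (auto simp: L2_converges_def)
  have d: "(\<lambda>x. u k x - y x) \<in> L2 M" for k
    by (intro L2_diff u y)
  have int: "set_integrable M \<omega> (\<lambda>x. (cmod (v x))\<^sup>2)" if "v \<in> L2 M" for v
    using that integrable_mult_indicator[OF assms(2), of "\<lambda>x. (cmod (v x))\<^sup>2"]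
    by (simp add: set_integrable_def L2_def)
  define q where "q v = (LINT x:\<omega>|M. (cmod (v x))\<^sup>2)" for v :: "'a \<Rightarrow> complex"
  have q: "(\<integral>\<^sup>+x\<in>\<omega>. ennreal ((cmod (v x))\<^sup>2) \<partial>M) = ennreal (q v)" if "v \<in> L2 M" for v
  proof -
    have "(\<integral>\<^sup>+x\<in>\<omega>. ennreal ((cmod (v x))\<^sup>2) \<partial>M) = (\<integral>\<^sup>+x. ennreal (indicator \<omega> x *\<^sub>R (cmod (v x))\<^sup>2) \<partial>M)"
      by (intro nn_integral_cong) (auto split: split_indicator)
    also have "\<dots> = ennreal (q v)"
      using int[OF that] unfolding q_def set_integrable_def set_lebesgue_integral_def
      by (intro nn_integral_eq_integral) auto
    finally show ?thesis .
  qed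
  have q_nonneg: "q v \<ge> 0" for v
    unfolding q_def set_lebesgue_integral_def by (intro integral_nonneg_AE) auto
  have "(\<lambda>k. \<integral>\<^sup>+x\<in>\<omega>. ennreal ((cmod (u k x - y x))\<^sup>2) \<partial>M) \<longlonglongrightarrow> 0"
  proof (rule tendsto_sandwich[OF _ _ tendsto_const])
    show "(\<lambda>k. \<integral>\<^sup>+x. ennreal ((cmod (u k x - y x))\<^sup>2) \<partial>M) \<longlonglongrightarrow> 0"
      using conv by (simp add: L2_converges_def)
    show "\<forall>\<^sub>F k in sequentially. (\<integral>\<^sup>+x\<in>\<omega>. ennreal ((cmod (u k x - y x))\<^sup>2) \<partial>M)
        \<le> (\<integral>\<^sup>+x. ennreal ((cmod (u k x - y x))\<^sup>2) \<partial>M)"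
      by (intro always_eventually allI nn_integral_mono) (auto split: split_indicator)
  qed simp
  then have a: "(\<lambda>k. q (\<lambda>x. u k x - y x)) \<longlonglongrightarrow> 0"
    unfolding q[OF d] using q_nonneg by (simp add: tendsto_ennreal_iff flip: ennreal_0)
  have key: "\<bar>q (u k) - q y\<bar> \<le> (1 + 1/e) * q (\<lambda>x. u k x - y x) + e * q y" if "e > 0" for e k
  proof -
    have pointwise: "\<bar>(cmod (u k x))\<^sup>2 - (cmod (y x))\<^sup>2\<bar> \<le>
        (1 + 1/e) * (cmod (u k x - y x))\<^sup>2 + e * (cmod (y x))\<^sup>2" for x
    proof -
      define D Y where "D = cmod (u k x - y x)" and "Y = cmod (y x)"
      have "\<bar>cmod (u k x) - Y\<bar> \<le> D"
        unfolding D_def Y_def by (rule norm_triangle_ineq3)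
      moreover have nn: "D \<ge> 0" "Y \<ge> 0"
        by (auto simp: D_def Y_def)
      ultimately have "\<bar>(cmod (u k x))\<^sup>2 - Y\<^sup>2\<bar> \<le> D * (D + 2 * Y)"
        unfolding power2_eq_square square_diff_square_factored abs_mult
        by (subst mult.commute, intro mult_mono) auto
      also have "2 * (D * Y) \<le> D\<^sup>2 / e + e * Y\<^sup>2"
      proof -
        have "0 \<le> (D - e * Y)\<^sup>2 / e" using that by simp
        also have "\<dots> = D\<^sup>2 / e + e * Y\<^sup>2 - 2 * (D * Y)"
          using that by (simp add: power2_diff field_simps power2_eq_square)
        finally show ?thesis by simp
      qed
      then have "D * (D + 2 * Y) \<le> (1 + 1/e) * D\<^sup>2 + e * Y\<^sup>2"
        by (simp add: algebra_simps power2_eq_square)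
      finally show ?thesis unfolding D_def Y_def .
    qed
    have "\<bar>q (u k) - q y\<bar> = \<bar>LINT x:\<omega>|M. (cmod (u k x))\<^sup>2 - (cmod (y x))\<^sup>2\<bar>"
      unfolding q_def by (subst set_integral_diff) (auto intro: int u y)
    also have "\<dots> \<le> (LINT x:\<omega>|M. (1 + 1/e) * (cmod (u k x - y x))\<^sup>2 + e * (cmod (y x))\<^sup>2)"
    proof -
      have 1: "set_integrable M \<omega> (\<lambda>x. (cmod (u k x))\<^sup>2 - (cmod (y x))\<^sup>2)"
        by (intro set_integral_diff int u y)
      have 2: "set_integrable M \<omega> (\<lambda>x. (1 + 1/e) * (cmod (u k x - y x))\<^sup>2 + e * (cmod (y x))\<^sup>2)"
        by (intro set_integral_add set_integrable_mult_right int d y)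
      have "\<bar>LINT x:\<omega>|M. (cmod (u k x))\<^sup>2 - (cmod (y x))\<^sup>2\<bar> \<le>
         (LINT x:\<omega>|M. \<bar>(cmod (u k x))\<^sup>2 - (cmod (y x))\<^sup>2\<bar>)"
        using set_integral_norm_bound[OF 1] by simp
      also have "\<dots> \<le> (LINT x:\<omega>|M. (1 + 1/e) * (cmod (u k x - y x))\<^sup>2 + e * (cmod (y x))\<^sup>2)"
        using 1 2 pointwise by (intro set_integral_mono set_integrable_abs) auto
      finally show ?thesis .
    qed
    also have "\<dots> = (1 + 1/e) * q (\<lambda>x. u k x - y x) + e * q y"
      unfolding q_def
      by (subst set_integral_add) (auto intro!: set_integrable_mult_right int d y)
    finally show ?thesis .
  qed
  have "(\<lambda>k. q (u k)) \<longlonglongrightarrow> q y"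
  proof (rule LIMSEQ_I)
    fix r :: real assume r: "r > 0"
    \<comment> \<open>The \<open>+ 1\<close> keeps the denominator positive when \<open>y\<close> vanishes on \<open>\<omega>\<close>.\<close>
    define e where "e = r / (2 * (q y + 1))"
    have e: "e > 0" using r q_nonneg[of y] by (simp add: e_def add_nonneg_pos)
    have small: "e * q y \<le> r / 2"
      using r q_nonneg[of y] by (simp add: e_def field_simps)
    have "(\<lambda>k. (1 + 1/e) * q (\<lambda>x. u k x - y x)) \<longlonglongrightarrow> (1 + 1/e) * 0"
      by (intro tendsto_intros a)
    then have "\<forall>\<^sub>F k in sequentially. (1 + 1/e) * q (\<lambda>x. u k x - y x) < r / 2"
      by (rule order_tendstoD) (use r in simp)
    then have "\<forall>\<^sub>F k in sequentially. norm (q (u k) - q y) < r"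
    proof eventually_elim
      case (elim k)
      have "\<bar>q (u k) - q y\<bar> \<le> (1 + 1/e) * q (\<lambda>x. u k x - y x) + e * q y"
        by (rule key[OF e])
      also have "\<dots> < r / 2 + r / 2"
        by (rule add_less_le_mono[OF elim small])
      finally show ?case by simp
    qed
    then show "\<exists>no. \<forall>k\<ge>no. norm (q (u k) - q y) < r"
      by (simp add: eventually_sequentially)
  qed
  then show ?thesis
    unfolding q[OF u] q[OF y] by (rule tendsto_ennrealI)
qed

section \<open>Series along a real orthonormal system\<close>

lemma borel_measurable_cnj [measurable (raw)]:
  "f \<in> borel_measurable M \<Longrightarrow> (\<lambda>x. cnj (f x)) \<in> borel_measurable M"
  by (rule measurable_compose, assumption) (intro borel_measurable_continuous_onI continuous_intros)

locale real_orthonormal_system =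
  fixes M :: "'a measure" and \<phi> :: "nat \<Rightarrow> 'a \<Rightarrow> real"
  assumes measurable_basis [measurable]: "\<And>j. \<phi> j \<in> borel_measurable M"
    and square_integrable: "\<And>j. integrable M (\<lambda>x. (\<phi> j x)\<^sup>2)"
    and orthonormal: "\<And>j k. (\<integral>x. \<phi> j x * \<phi> k x \<partial>M) = (if j = k then 1 else 0)"
begin

lemma integrable_product: "integrable M (\<lambda>x. \<phi> j x * \<phi> k x)"
proof (rule Bochner_Integration.integrable_bound)
  show "integrable M (\<lambda>x. (\<phi> j x)\<^sup>2 + (\<phi> k x)\<^sup>2)"
    by (intro Bochner_Integration.integrable_add square_integrable)
  have "\<bar>\<phi> j x * \<phi> k x\<bar> \<le> (\<phi> j x)\<^sup>2 + (\<phi> k x)\<^sup>2" for x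
  proof -
    have "2 * (\<bar>\<phi> j x\<bar> * \<bar>\<phi> k x\<bar>) \<le> (\<phi> j x)\<^sup>2 + (\<phi> k x)\<^sup>2"
      using sum_squares_bound[of "\<bar>\<phi> j x\<bar>" "\<bar>\<phi> k x\<bar>"] by simp
    moreover have "0 \<le> \<bar>\<phi> j x\<bar> * \<bar>\<phi> k x\<bar>" by simp
    ultimately show ?thesis unfolding abs_mult by linarith
  qed
  then show "AE x in M. norm (\<phi> j x * \<phi> k x) \<le> norm ((\<phi> j x)\<^sup>2 + (\<phi> k x)\<^sup>2)"
    by (intro AE_I2) simp
qed simp

lemma set_integrable_product: "\<omega> \<in> sets M \<Longrightarrow> set_integrable M \<omega> (\<lambda>x. \<phi> j x * \<phi> k x)"
  unfolding set_integrable_def by (intro integrable_mult_indicator integrable_product)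

definition gram :: "'a set \<Rightarrow> nat \<Rightarrow> nat \<Rightarrow> real" where
  "gram \<omega> j k = (LINT x:\<omega>|M. \<phi> j x * \<phi> k x)"

text \<open>
  The energy on \<open>\<omega>\<close> of the finite sum with coefficients \<open>z\<close>, as an explicit quadratic form: unlike an
  integral over \<open>\<omega>\<close>, it shows at once the measurability in parameters of \<open>z\<close>, and its
  expectation can be taken term by term.
\<close>

definition energy_form :: "'a set \<Rightarrow> nat set \<Rightarrow> (nat \<Rightarrow> complex) \<Rightarrow> real" where
  "energy_form \<omega> A z = (\<Sum>j\<in>A. \<Sum>k\<in>A. Re (z j * cnj (z k)) * gram \<omega> j k)"

lemma gram_space: "gram (space M) j k = (if j = k then 1 else 0)"
  by (simp add: gram_def set_integral_space integrable_product orthonormal)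

lemma energy_form_space:
  assumes "finite A"
  shows "energy_form (space M) A z = (\<Sum>j\<in>A. (cmod (z j))\<^sup>2)"
  using assms
  by (simp add: energy_form_def gram_space cmod_power2
      power2_eq_square[symmetric] if_distrib[of "\<lambda>x. _ * x"] cong: if_cong)

lemma energy_form_eq_integral:
  assumes "finite A" and \<omega>: "\<omega> \<in> sets M"
  shows "(\<integral>\<^sup>+x\<in>\<omega>. ennreal ((cmod (\<Sum>j\<in>A. z j * complex_of_real (\<phi> j x)))\<^sup>2) \<partial>M) =
      ennreal (energy_form \<omega> A z)"
    and "energy_form \<omega> A z \<ge> 0"
proof -
  have pointwise: "(cmod (\<Sum>j\<in>A. z j * complex_of_real (\<phi> j x)))\<^sup>2 =
      (\<Sum>j\<in>A. \<Sum>k\<in>A. Re (z j * cnj (z k)) * (\<phi> j x * \<phi> k x))" for x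
  proof -
    let ?s = "\<Sum>j\<in>A. z j * complex_of_real (\<phi> j x)"
    have "(cmod ?s)\<^sup>2 = Re (?s * cnj ?s)"
      by (simp only: complex_norm_square[symmetric] Re_complex_of_real)
    also have "?s * cnj ?s = (\<Sum>j\<in>A. \<Sum>k\<in>A. z j * cnj (z k) * complex_of_real (\<phi> j x * \<phi> k x))"
      by (simp add: cnj_sum sum_product mult_ac)
    finally show ?thesis by (simp del: of_real_mult)
  qed
  have "set_integrable M \<omega> (\<lambda>x. c * (\<phi> j x * \<phi> k x))" for c j k
    by (intro set_integrable_mult_right set_integrable_product \<omega>)
  note int' = this[unfolded set_integrable_def]
  have int: "set_integrable M \<omega> (\<lambda>x. \<Sum>j\<in>A. \<Sum>k\<in>A. Re (z j * cnj (z k)) * (\<phi> j x * \<phi> k x))"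
    unfolding set_integrable_def scaleR_sum_right
    by (intro Bochner_Integration.integrable_sum int')
  have eq: "(LINT x:\<omega>|M. (cmod (\<Sum>j\<in>A. z j * complex_of_real (\<phi> j x)))\<^sup>2) = energy_form \<omega> A z"
  proof -
    have "(LINT x:\<omega>|M. (cmod (\<Sum>j\<in>A. z j * complex_of_real (\<phi> j x)))\<^sup>2) =
        (\<Sum>j\<in>A. \<Sum>k\<in>A. LINT x:\<omega>|M. Re (z j * cnj (z k)) * (\<phi> j x * \<phi> k x))"
      unfolding pointwise set_lebesgue_integral_def scaleR_sum_right
      by (simp only: Bochner_Integration.integral_sum Bochner_Integration.integrable_sum int')
    then show ?thesis
      by (simp only: set_integral_mult_right energy_form_def gram_def)
  qed
  show "energy_form \<omega> A z \<ge> 0"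
    unfolding eq[symmetric] set_lebesgue_integral_def by (intro integral_nonneg_AE) auto
  have "(\<integral>\<^sup>+x\<in>\<omega>. ennreal ((cmod (\<Sum>j\<in>A. z j * complex_of_real (\<phi> j x)))\<^sup>2) \<partial>M) =
      (\<integral>\<^sup>+x. ennreal (indicator \<omega> x *\<^sub>R (cmod (\<Sum>j\<in>A. z j * complex_of_real (\<phi> j x)))\<^sup>2) \<partial>M)"
    by (intro nn_integral_cong) (auto split: split_indicator)
  also have "\<dots> = ennreal (energy_form \<omega> A z)"
    using int unfolding eq[symmetric] set_lebesgue_integral_def set_integrable_def pointwise[symmetric]
    by (intro nn_integral_eq_integral) auto
  finally show "(\<integral>\<^sup>+x\<in>\<omega>. ennreal ((cmod (\<Sum>j\<in>A. z j * complex_of_real (\<phi> j x)))\<^sup>2) \<partial>M) =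
      ennreal (energy_form \<omega> A z)" .
qed

lemma nn_integral_norm_sum:
  assumes "finite A"
  shows "(\<integral>\<^sup>+x. ennreal ((cmod (\<Sum>j\<in>A. z j * complex_of_real (\<phi> j x)))\<^sup>2) \<partial>M) =
      ennreal (\<Sum>j\<in>A. (cmod (z j))\<^sup>2)"
  using energy_form_eq_integral(1)[OF assms sets.top, of z] assms
  by (simp add: energy_form_space nn_set_integral_space)

lemma energy_form_le:
  assumes "finite A" "\<omega> \<in> sets M"
  shows "energy_form \<omega> A z \<le> (\<Sum>j\<in>A. (cmod (z j))\<^sup>2)"
proof -
  have "ennreal (energy_form \<omega> A z) \<le> ennreal (\<Sum>j\<in>A. (cmod (z j))\<^sup>2)"
    unfolding energy_form_eq_integral(1)[OF assms, symmetric] nn_integral_norm_sum[OF assms(1), symmetric]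
    by (intro nn_integral_mono) (auto split: split_indicator)
  then show ?thesis by (simp add: sum_nonneg)
qed

lemma sum_in_L2: "finite A \<Longrightarrow> (\<lambda>x. \<Sum>j\<in>A. z j * complex_of_real (\<phi> j x)) \<in> L2 M"
  by (simp add: L2_nn_integral_iff nn_integral_norm_sum)

text \<open>
  The theorem of Riesz and Fischer: by orthonormality, the squared distance of two partial
  sums is a block of the convergent series \<open>\<Sum> |z\<^sub>j|\<^sup>2\<close>.
\<close>

lemma series_converges:
  assumes z: "summable (\<lambda>j. (cmod (z j))\<^sup>2)"
  shows "L2_converges M (\<lambda>N x. \<Sum>j<N. z j * complex_of_real (\<phi> j x))
    (L2_suminf M (\<lambda>j x. z j * complex_of_real (\<phi> j x)))"
proof -
  let ?u = "\<lambda>N x. \<Sum>j<N. z j * complex_of_real (\<phi> j x)"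
  have diff: "(\<integral>\<^sup>+x. ennreal ((cmod (?u m x - ?u n x))\<^sup>2) \<partial>M) = ennreal (\<Sum>j\<in>{m..<n}. (cmod (z j))\<^sup>2)"
    if "m \<le> n" for m n
  proof -
    have "cmod (?u m x - ?u n x) = cmod (\<Sum>j\<in>{m..<n}. z j * complex_of_real (\<phi> j x))" for x
      using that
      by (subst norm_minus_commute) (simp add: lessThan_atLeast0 sum_diff_nat_ivl)
    then show ?thesis by (simp add: nn_integral_norm_sum)
  qed
  have "\<exists>y. L2_converges M ?u y"
  proof (rule L2_complete)
    fix e :: real assume "e > 0"
    with z obtain N where N: "\<And>m n. m \<ge> N \<Longrightarrow> norm (\<Sum>j\<in>{m..<n}. (cmod (z j))\<^sup>2) < e"
      unfolding summable_Cauchy by metis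
    have le: "(\<integral>\<^sup>+x. ennreal ((cmod (?u m x - ?u n x))\<^sup>2) \<partial>M) \<le> ennreal e" if "m \<ge> N" "m \<le> n" for m n
      unfolding diff[OF that(2)] using N[OF that(1), of n] by (intro ennreal_leI) simp
    show "\<exists>N. \<forall>m\<ge>N. \<forall>n\<ge>N. (\<integral>\<^sup>+x. ennreal ((cmod (?u m x - ?u n x))\<^sup>2) \<partial>M) \<le> ennreal e"
    proof (intro exI[of _ N] allI impI)
      fix m n assume "m \<ge> N" "n \<ge> N"
      then show "(\<integral>\<^sup>+x. ennreal ((cmod (?u m x - ?u n x))\<^sup>2) \<partial>M) \<le> ennreal e"
        using le[of m n] le[of n m] by (cases "m \<le> n") (simp_all add: norm_minus_commute)
    qed
  qed (simp add: sum_in_L2)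
  then show ?thesis
    unfolding L2_suminf_def by (rule someI_ex)
qed

lemma energy_form_tendsto:
  assumes "summable (\<lambda>j. (cmod (z j))\<^sup>2)" and \<omega>: "\<omega> \<in> sets M"
  shows "(\<lambda>N. ennreal (energy_form \<omega> {..<N} z)) \<longlonglongrightarrow>
    (\<integral>\<^sup>+x\<in>\<omega>. ennreal ((cmod (L2_suminf M (\<lambda>j x. z j * complex_of_real (\<phi> j x)) x))\<^sup>2) \<partial>M)"
  using L2_converges_set_norm[OF series_converges[OF assms(1)] \<omega>]
  by (simp add: energy_form_eq_integral(1)[OF _ \<omega>])

text \<open>
  Almost surely the energy at every time is the limit of the quadratic forms of the partial sums; their
  lower limit \<open>E\<close> is a jointly measurable version of it. So Tonelli's theorem applies to \<open>E\<close>, and it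
  suffices to take expectations at a fixed time. There the quadratic forms are dominated by the
  constant \<open>C \<Sum> r\<^sub>j\<close>, and decorrelation reduces their expectations to the diagonal terms. The
  result does not depend on the time, whence the factor \<open>T\<close>.

  The bound on \<open>Z\<close> is only almost sure because signs are
  \<open>\<plusminus>1\<close> only almost surely; the exceptional set must not depend on the time.
\<close>

lemma expected_energy:
  fixes P :: "'p measure" and Z :: "nat \<Rightarrow> 'p \<Rightarrow> real \<Rightarrow> complex"
  assumes P: "prob_space P" and \<omega> [measurable]: "\<omega> \<in> sets M" and T: "0 \<le> T"
    and Z [measurable]: "\<And>j. (\<lambda>(\<nu>, t). Z j \<nu> t) \<in> borel_measurable (P \<Otimes>\<^sub>M lborel)"
    and r: "summable r" "\<And>j. r j \<ge> 0"
    and bound: "AE \<nu> in P. \<forall>j t. (cmod (Z j \<nu> t))\<^sup>2 \<le> C * r j"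
    and decorrelated: "\<And>j k t. (\<integral>\<nu>. Z j \<nu> t * cnj (Z k \<nu> t) \<partial>P) = complex_of_real (if j = k then r j else 0)"
  shows "(\<integral>\<^sup>+\<nu>. (\<integral>\<^sup>+t\<in>{0..T}. (\<integral>\<^sup>+x\<in>\<omega>.
      ennreal ((cmod (L2_suminf M (\<lambda>j x. Z j \<nu> t * complex_of_real (\<phi> j x)) x))\<^sup>2) \<partial>M) \<partial>lborel) \<partial>P) =
    ennreal T * (\<Sum>j. ennreal (r j) * (\<integral>\<^sup>+x\<in>\<omega>. ennreal ((\<phi> j x)\<^sup>2) \<partial>M))" (is "_ = _ * ?S")
proof -
  interpret P: prob_space P by fact
  interpret pair: pair_sigma_finite P lborel
    by (intro pair_sigma_finite.intro P.sigma_finite_measure_axioms lborel.sigma_finite_measure_axioms)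
  define q where "q N \<nu> t = energy_form \<omega> {..<N} (\<lambda>j. Z j \<nu> t)" for N \<nu> t
  have Z' [measurable]: "(\<lambda>\<nu>. Z j \<nu> t) \<in> borel_measurable P" for j t
    using Z[of j] by measurable
  have q_measurable [measurable]: "(\<lambda>(\<nu>, t). q N \<nu> t) \<in> borel_measurable (P \<Otimes>\<^sub>M lborel)" for N
    unfolding q_def energy_form_def by measurable
  have q_measurable' [measurable]: "(\<lambda>\<nu>. q N \<nu> t) \<in> borel_measurable P" for N t
    unfolding q_def energy_form_def by measurable
  have C_nonneg: "C * r j \<ge> 0" for j
  proof -
    have "AE \<nu> in P. 0 \<le> C * r j"
      using bound by eventually_elim (meson order_trans zero_le_power2)
    then show ?thesis by simp
  qed
  have q_le: "AE \<nu> in P. \<forall>N t. q N \<nu> t \<le> (\<Sum>j. C * r j)"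
    using bound
  proof eventually_elim
    case (elim \<nu>)
    show ?case
    proof (intro allI)
      fix N t
      have "q N \<nu> t \<le> (\<Sum>j<N. (cmod (Z j \<nu> t))\<^sup>2)"
        unfolding q_def by (intro energy_form_le \<omega>) simp
      also have "\<dots> \<le> (\<Sum>j<N. C * r j)"
        using elim by (intro sum_mono) auto
      also have "\<dots> \<le> (\<Sum>j. C * r j)"
        by (intro sum_le_suminf summable_mult r C_nonneg) auto
      finally show "q N \<nu> t \<le> (\<Sum>j. C * r j)" .
    qed
  qed
  define E where "E \<nu> t = liminf (\<lambda>N. ennreal (q N \<nu> t))" for \<nu> t
  have E_measurable [measurable]: "(\<lambda>(\<nu>, t). E \<nu> t) \<in> borel_measurable (P \<Otimes>\<^sub>M lborel)"
    unfolding E_def by measurable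
  have E_measurable' [measurable]: "(\<lambda>\<nu>. E \<nu> t) \<in> borel_measurable P" for t
    unfolding E_def by measurable
  have q_tendsto: "AE \<nu> in P. \<forall>t. (\<lambda>N. ennreal (q N \<nu> t)) \<longlonglongrightarrow> (\<integral>\<^sup>+x\<in>\<omega>.
      ennreal ((cmod (L2_suminf M (\<lambda>j x. Z j \<nu> t * complex_of_real (\<phi> j x)) x))\<^sup>2) \<partial>M)"
    using bound
  proof eventually_elim
    case (elim \<nu>)
    have "summable (\<lambda>j. (cmod (Z j \<nu> t))\<^sup>2)" for t
      by (rule summable_comparison_test'[OF summable_mult[OF r(1), of C]]) (use elim in auto)
    then show ?case
      unfolding q_def by (intro allI energy_form_tendsto \<omega>)
  qed
  have E_mean: "(\<integral>\<^sup>+\<nu>. E \<nu> t \<partial>P) = ?S" for t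
  proof (rule LIMSEQ_unique)
    show "(\<lambda>N. \<integral>\<^sup>+\<nu>. ennreal (q N \<nu> t) \<partial>P) \<longlonglongrightarrow> (\<integral>\<^sup>+\<nu>. E \<nu> t \<partial>P)"
    proof (rule nn_integral_dominated_convergence[where w = "\<lambda>_. ennreal (\<Sum>j. C * r j)"])
      show "AE \<nu> in P. ennreal (q N \<nu> t) \<le> ennreal (\<Sum>j. C * r j)" for N
        using q_le by eventually_elim (auto intro: ennreal_leI)
      show "AE \<nu> in P. (\<lambda>N. ennreal (q N \<nu> t)) \<longlonglongrightarrow> E \<nu> t"
        using q_tendsto
      proof eventually_elim
        case (elim \<nu>)
        then have "(\<lambda>N. ennreal (q N \<nu> t)) \<longlonglongrightarrow> (\<integral>\<^sup>+x\<in>\<omega>.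
            ennreal ((cmod (L2_suminf M (\<lambda>j x. Z j \<nu> t * complex_of_real (\<phi> j x)) x))\<^sup>2) \<partial>M)" ..
        from this lim_imp_Liminf[OF trivial_limit_sequentially this] show ?case
          by (simp add: E_def)
      qed
      show "(\<integral>\<^sup>+\<nu>. ennreal (\<Sum>j. C * r j) \<partial>P) < \<infinity>"
        by (simp add: P.emeasure_space_1)
    qed measurable
    have int: "integrable P (\<lambda>\<nu>. Z j \<nu> t * cnj (Z k \<nu> t))" for j k
    proof (rule P.integrable_const_bound)
      show "AE \<nu> in P. norm (Z j \<nu> t * cnj (Z k \<nu> t)) \<le> C * r j + C * r k"
        using bound
      proof eventually_elim
        case (elim \<nu>)
        have "norm (Z j \<nu> t * cnj (Z k \<nu> t)) \<le> (cmod (Z j \<nu> t))\<^sup>2 + (cmod (Z k \<nu> t))\<^sup>2"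
        proof -
          have "2 * (cmod (Z j \<nu> t) * cmod (Z k \<nu> t)) \<le> (cmod (Z j \<nu> t))\<^sup>2 + (cmod (Z k \<nu> t))\<^sup>2"
            using sum_squares_bound[of "cmod (Z j \<nu> t)" "cmod (Z k \<nu> t)"] by simp
          moreover have "0 \<le> cmod (Z j \<nu> t) * cmod (Z k \<nu> t)" by simp
          ultimately show ?thesis unfolding norm_mult complex_mod_cnj by linarith
        qed
        with elim show ?case by (meson add_mono order_trans)
      qed
    qed simp
    have int_Re: "integrable P (\<lambda>\<nu>. Re (Z j \<nu> t * cnj (Z k \<nu> t)) * c)" for j k c
      by (intro integrable_mult_left integrable_Re int)
    have Re_mean: "(\<integral>\<nu>. Re (Z j \<nu> t * cnj (Z k \<nu> t)) \<partial>P) = (if j = k then r j else 0)" for j k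
      using integral_Re[OF int[of j k]] decorrelated[where j=j and k=k and t=t] by simp
    have "(\<integral>\<^sup>+\<nu>. ennreal (q N \<nu> t) \<partial>P) = (\<Sum>j<N. ennreal (r j) * (\<integral>\<^sup>+x\<in>\<omega>. ennreal ((\<phi> j x)\<^sup>2) \<partial>M))" for N
    proof -
      have diag: "(\<integral>\<^sup>+x\<in>\<omega>. ennreal ((\<phi> j x)\<^sup>2) \<partial>M) = ennreal (gram \<omega> j j)" "gram \<omega> j j \<ge> 0" for j
        using energy_form_eq_integral[of "{j}" \<omega> "\<lambda>_. 1"] by (simp_all add: energy_form_def)
      have "(\<integral>\<^sup>+\<nu>. ennreal (q N \<nu> t) \<partial>P) = ennreal (\<integral>\<nu>. q N \<nu> t \<partial>P)"
      proof (rule nn_integral_eq_integral)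
        show "integrable P (\<lambda>\<nu>. q N \<nu> t)"
          unfolding q_def energy_form_def by (intro Bochner_Integration.integrable_sum int_Re)
        show "AE \<nu> in P. 0 \<le> q N \<nu> t"
          unfolding q_def by (intro AE_I2 energy_form_eq_integral(2) \<omega>) simp
      qed
      also have "(\<integral>\<nu>. q N \<nu> t \<partial>P) =
          (\<Sum>j<N. \<Sum>k<N. (\<integral>\<nu>. Re (Z j \<nu> t * cnj (Z k \<nu> t)) \<partial>P) * gram \<omega> j k)"
        unfolding q_def energy_form_def
        by (simp only: Bochner_Integration.integral_sum Bochner_Integration.integrable_sum int_Re
            integral_mult_left_zero)
      also have "\<dots> = (\<Sum>j<N. r j * gram \<omega> j j)"
        unfolding Re_mean by (simp add: if_distrib[of "\<lambda>x. x * _"] cong: if_cong)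
      also have "ennreal \<dots> = (\<Sum>j<N. ennreal (r j) * (\<integral>\<^sup>+x\<in>\<omega>. ennreal ((\<phi> j x)\<^sup>2) \<partial>M))"
        by (simp add: diag r ennreal_mult flip: sum_ennreal)
      finally show ?thesis .
    qed
    then show "(\<lambda>N. \<integral>\<^sup>+\<nu>. ennreal (q N \<nu> t) \<partial>P) \<longlonglongrightarrow> ?S"
      by (simp add: summable_LIMSEQ summableI)
  qed
  have "(\<integral>\<^sup>+\<nu>. (\<integral>\<^sup>+t\<in>{0..T}. (\<integral>\<^sup>+x\<in>\<omega>.
      ennreal ((cmod (L2_suminf M (\<lambda>j x. Z j \<nu> t * complex_of_real (\<phi> j x)) x))\<^sup>2) \<partial>M) \<partial>lborel) \<partial>P) =
    (\<integral>\<^sup>+\<nu>. (\<integral>\<^sup>+t\<in>{0..T}. E \<nu> t \<partial>lborel) \<partial>P)"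
  proof (rule nn_integral_cong_AE, use q_tendsto in eventually_elim)
    case (elim \<nu>)
    then have "E \<nu> t = (\<integral>\<^sup>+x\<in>\<omega>.
        ennreal ((cmod (L2_suminf M (\<lambda>j x. Z j \<nu> t * complex_of_real (\<phi> j x)) x))\<^sup>2) \<partial>M)" for t
      unfolding E_def by (intro lim_imp_Liminf) auto
    then show ?case by simp
  qed
  also have "\<dots> = (\<integral>\<^sup>+t. (\<integral>\<^sup>+\<nu>. E \<nu> t * indicator {0..T} t \<partial>P) \<partial>lborel)"
    by (rule pair.Fubini'[symmetric]) measurable
  also have "\<dots> = (\<integral>\<^sup>+t\<in>{0..T}. ?S \<partial>lborel)"
    by (intro nn_integral_cong) (simp add: nn_integral_multc E_mean)
  also have "\<dots> = ennreal T * ?S"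
    using T by (subst nn_integral_cmult_indicator) (auto simp: mult.commute)
  finally show ?thesis .
qed

end

section \<open>Random signs\<close>

lemma bernoulli_sign_AE:
  assumes "prob_space P" "bernoulli_sign P X"
  shows "AE \<nu> in P. X \<nu> = 1 \<or> X \<nu> = - 1"
proof -
  interpret prob_space P by fact
  have [measurable]: "X \<in> borel_measurable P"
    using assms(2) by (simp add: bernoulli_sign_def)
  have "measure P {\<nu> \<in> space P. X \<nu> = 1 \<or> X \<nu> = - 1} =
      measure P ({\<nu> \<in> space P. X \<nu> = 1} \<union> {\<nu> \<in> space P. X \<nu> = - 1})"
    by (rule arg_cong[where f = "measure P"]) auto
  also have "\<dots> = 1"
    using assms(2) by (subst finite_measure_Union) (auto simp: bernoulli_sign_def)
  finally have "AE \<nu> in P. \<nu> \<in> {\<nu> \<in> space P. X \<nu> = 1 \<or> X \<nu> = - 1}"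
    by (subst AE_in_set_eq_1) measurable
  then show ?thesis by eventually_elim simp
qed

lemma bernoulli_sign_mean:
  assumes "prob_space P" "bernoulli_sign P X"
  shows "integrable P X" "(\<integral>\<nu>. X \<nu> \<partial>P) = 0"
proof -
  interpret prob_space P by fact
  have [measurable]: "X \<in> borel_measurable P"
    using assms(2) by (simp add: bernoulli_sign_def)
  show int: "integrable P X"
  proof (rule integrable_const_bound)
    show "AE \<nu> in P. norm (X \<nu>) \<le> 1"
      using bernoulli_sign_AE[OF assms] by eventually_elim auto
  qed measurable
  let ?A = "{\<nu> \<in> space P. X \<nu> = 1}" and ?B = "{\<nu> \<in> space P. X \<nu> = - 1}"
  have "(\<integral>\<nu>. X \<nu> \<partial>P) = (\<integral>\<nu>. indicator ?A \<nu> - indicator ?B \<nu> \<partial>P)"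
  proof (rule integral_cong_AE)
    show "AE \<nu> in P. X \<nu> = indicator ?A \<nu> - indicator ?B \<nu>"
      using bernoulli_sign_AE[OF assms] AE_space by eventually_elim (auto simp: indicator_def)
  qed measurable
  also have "\<dots> = 0"
    using assms(2) by (subst Bochner_Integration.integral_diff) (auto simp: bernoulli_sign_def emeasure_eq_measure)
  finally show "(\<integral>\<nu>. X \<nu> \<partial>P) = 0" .
qed

lemma independent_signs_AE:
  assumes "prob_space P" "independent_signs P X"
  shows "AE \<nu> in P. \<forall>j. \<bar>X j \<nu>\<bar> = 1"
proof -
  have "AE \<nu> in P. \<bar>X j \<nu>\<bar> = 1" for j
    using bernoulli_sign_AE[OF assms(1), of "X j"] assms(2)
    by (auto simp: independent_signs_def elim!: eventually_mono)
  then show ?thesis by (simp add: AE_all_countable)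
qed

lemma independent_signs_correlation:
  assumes P: "prob_space P" and X: "independent_signs P X"
  shows "(\<integral>\<nu>. X j \<nu> * X k \<nu> \<partial>P) = (if j = k then 1 else 0)"
proof -
  interpret prob_space P by fact
  have sign: "bernoulli_sign P (X i)" for i
    using X by (simp add: independent_signs_def)
  note mean = bernoulli_sign_mean[OF P sign]
  have [measurable]: "X i \<in> borel_measurable P" for i
    using sign by (simp add: bernoulli_sign_def)
  show ?thesis
  proof (cases "j = k")
    case True
    have "AE \<nu> in P. X k \<nu> * X k \<nu> = 1"
      using independent_signs_AE[OF P X] by eventually_elim (metis abs_mult_self_eq mult_1)
    then have "(\<integral>\<nu>. X k \<nu> * X k \<nu> \<partial>P) = (\<integral>\<nu>. 1 \<partial>P)"
      by (intro integral_cong_AE) auto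
    with True show ?thesis by (simp add: prob_space)
  next
    case False
    have "indep_vars (\<lambda>_. borel) X {j, k}"
      using X by (auto simp: independent_signs_def intro: indep_vars_subset)
    then have "(\<integral>\<nu>. (\<Prod>i\<in>{j, k}. X i \<nu>) \<partial>P) = (\<Prod>i\<in>{j, k}. \<integral>\<nu>. X i \<nu> \<partial>P)"
      by (intro indep_vars_lebesgue_integral) (auto simp: mean)
    with False show ?thesis by (simp add: mean)
  qed
qed

section \<open>Infima of weighted averages\<close>

text \<open>
  A weighted average is at least the infimum, and the weights concentrated at one index attain each single
  value. Finiteness of \<open>a\<close> matters: for \<open>a = \<infinity>\<close> and positive \<open>g j\<close> tending to \<open>0\<close>, the left side is
  infinite and the right side is \<open>\<infinity> * 0 = 0\<close>.
\<close>

lemma Inf_weighted_averages: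
  fixes w :: "'c \<Rightarrow> nat \<Rightarrow> real" and g :: "nat \<Rightarrow> ennreal"
  assumes a: "0 < a" "a < top"
    and weights: "\<And>c j. c \<in> S \<Longrightarrow> w c j \<ge> 0" "\<And>c. c \<in> S \<Longrightarrow> w c sums 1"
    and concentrated: "\<And>k. \<exists>c\<in>S. \<forall>j. w c j = (if j = k then 1 else 0)"
  shows "(INF c\<in>S. a * (\<Sum>j. ennreal (w c j) * g j)) = a * (INF j. g j)"
proof (rule antisym)
  show "a * (INF j. g j) \<le> (INF c\<in>S. a * (\<Sum>j. ennreal (w c j) * g j))"
  proof (intro INF_greatest mult_left_mono)
    fix c assume c: "c \<in> S"
    have "(\<Sum>j. ennreal (w c j)) = 1"
      using weights[OF c] by (subst suminf_ennreal2) (auto simp: sums_iff)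
    then have "(INF j. g j) = (\<Sum>j. ennreal (w c j) * (INF j. g j))"
      by (simp only: ennreal_suminf_multc mult_1)
    also have "\<dots> \<le> (\<Sum>j. ennreal (w c j) * g j)"
      by (intro suminf_le summableI mult_left_mono INF_lower) auto
    finally show "(INF j. g j) \<le> (\<Sum>j. ennreal (w c j) * g j)" .
  qed simp
  have "(INF c\<in>S. a * (\<Sum>j. ennreal (w c j) * g j)) \<le> a * g k" for k
  proof -
    obtain c where c: "c \<in> S" "\<And>j. w c j = (if j = k then 1 else 0)"
      using concentrated[of k] by blast
    have "(\<Sum>j. ennreal (w c j) * g j) = (\<Sum>j\<in>{k}. ennreal (w c j) * g j)"
      by (rule suminf_finite) (auto simp: c)
    then have "a * g k = a * (\<Sum>j. ennreal (w c j) * g j)"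
      by (simp add: c)
    then show ?thesis using c(1) by (auto intro: INF_lower2)
  qed
  then have "(INF c\<in>S. a * (\<Sum>j. ennreal (w c j) * g j)) / a \<le> (INF j. g j)"
    using a by (intro INF_greatest divide_le_posI_ennreal)
  from mult_left_mono[OF this, of a] a
  show "(INF c\<in>S. a * (\<Sum>j. ennreal (w c j) * g j)) \<le> a * (INF j. g j)"
    by (simp add: ennreal_times_divide ennreal_mult_divide_eq mult.commute[of a])
qed

section \<open>The randomized observability constants\<close>

context real_orthonormal_system
begin

text \<open>
  The time dependence is a phase of modulus one, so the mean square of the \<open>j\<close>-th
  coefficient is \<open>|\<alpha>\<^sub>j|\<^sup>2\<close> whatever the frequencies \<open>\<mu>\<close> are.
\<close>

lemma expected_schroedinger_energy:
  fixes P :: "'p measure" and \<alpha> :: "nat \<Rightarrow> complex"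
  assumes P: "prob_space P" and signs: "independent_signs P \<beta>" and \<omega>: "\<omega> \<in> sets M" and T: "0 \<le> T"
    and \<alpha>: "\<alpha> \<in> ell2"
  shows "(\<integral>\<^sup>+\<nu>. (\<integral>\<^sup>+t\<in>{0..T}. (\<integral>\<^sup>+x\<in>\<omega>. ennreal ((cmod (L2_suminf M (\<lambda>j x.
      complex_of_real (\<beta> j \<nu>) * \<alpha> j * exp (\<i> * complex_of_real (\<mu> j * t)) * complex_of_real (\<phi> j x)) x))\<^sup>2)
        \<partial>M) \<partial>lborel) \<partial>P) =
    ennreal T * (\<Sum>j. ennreal ((cmod (\<alpha> j))\<^sup>2) * (\<integral>\<^sup>+x\<in>\<omega>. ennreal ((\<phi> j x)\<^sup>2) \<partial>M))"
proof (rule expected_energy[OF P \<omega> T])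
  define e where "e j t = exp (\<i> * complex_of_real (\<mu> j * t))" for j t
  have norm_e: "cmod (e j t) = 1" for j t
    by (simp add: e_def)
  have e_cnj: "e j t * cnj (e j t) = 1" for j t
    by (simp add: complex_norm_square[symmetric] norm_e)
  have [measurable]: "\<beta> j \<in> borel_measurable P" for j
    using signs by (simp add: independent_signs_def bernoulli_sign_def)
  have [measurable]: "(\<lambda>t. exp (\<i> * complex_of_real (\<mu> j * t))) \<in> borel_measurable borel" for j
    by (intro borel_measurable_continuous_onI continuous_intros)
  show "(\<lambda>(\<nu>, t). complex_of_real (\<beta> j \<nu>) * \<alpha> j * exp (\<i> * complex_of_real (\<mu> j * t)))
      \<in> borel_measurable (P \<Otimes>\<^sub>M lborel)" for j
    by measurable
  show "summable (\<lambda>j. (cmod (\<alpha> j))\<^sup>2)"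
    using \<alpha> by (simp add: ell2_def)
  show "AE \<nu> in P. \<forall>j t. (cmod (complex_of_real (\<beta> j \<nu>) * \<alpha> j * exp (\<i> * complex_of_real (\<mu> j * t))))\<^sup>2
      \<le> 1 * (cmod (\<alpha> j))\<^sup>2"
    using independent_signs_AE[OF P signs] by eventually_elim (simp add: norm_mult)
  fix j k t
  have "(\<integral>\<nu>. complex_of_real (\<beta> j \<nu>) * \<alpha> j * e j t * cnj (complex_of_real (\<beta> k \<nu>) * \<alpha> k * e k t) \<partial>P) =
      (\<integral>\<nu>. complex_of_real (\<beta> j \<nu> * \<beta> k \<nu>) * (\<alpha> j * cnj (\<alpha> k) * (e j t * cnj (e k t))) \<partial>P)"
    by (intro Bochner_Integration.integral_cong) (simp_all add: mult_ac)
  also have "\<dots> = complex_of_real (\<integral>\<nu>. \<beta> j \<nu> * \<beta> k \<nu> \<partial>P) * (\<alpha> j * cnj (\<alpha> k) * (e j t * cnj (e k t)))"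
    by (simp only: integral_mult_left_zero integral_complex_of_real)
  also have "\<dots> = complex_of_real (if j = k then (cmod (\<alpha> j))\<^sup>2 else 0)"
    by (simp add: independent_signs_correlation[OF P signs] e_cnj complex_norm_square del: of_real_power)
  finally show "(\<integral>\<nu>. complex_of_real (\<beta> j \<nu>) * \<alpha> j * exp (\<i> * complex_of_real (\<mu> j * t)) *
      cnj (complex_of_real (\<beta> k \<nu>) * \<alpha> k * exp (\<i> * complex_of_real (\<mu> k * t))) \<partial>P) =
    complex_of_real (if j = k then (cmod (\<alpha> j))\<^sup>2 else 0)"
    by (simp only: e_def)
qed simp

text \<open>
  Within one mode the two travelling components do interfere in time, since \<open>e\<^sup>i\<^sup>\<mu>\<^sup>t\<close> and
  \<open>e\<^sup>-\<^sup>i\<^sup>\<mu>\<^sup>t\<close> are in general not orthogonal on \<open>[0,T]\<close>. It is the vanishing correlation of \<open>\<beta>1\<close> with \<open>\<beta>2\<close>, used also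
  for equal indices, that removes this interference and leaves \<open>|\<alpha>\<^sub>j|\<^sup>2 + |\<gamma>\<^sub>j|\<^sup>2\<close>.
\<close>

lemma expected_wave_energy:
  fixes P :: "'p measure" and \<alpha> \<gamma> :: "nat \<Rightarrow> complex"
  assumes P: "prob_space P" and signs1: "independent_signs P \<beta>1" and signs2: "independent_signs P \<beta>2"
    and cross: "\<And>j k. (\<integral>\<nu>. \<beta>1 j \<nu> * \<beta>2 k \<nu> \<partial>P) = 0"
    and \<omega>: "\<omega> \<in> sets M" and T: "0 \<le> T" and \<alpha>: "\<alpha> \<in> ell2" and \<gamma>: "\<gamma> \<in> ell2"
  shows "(\<integral>\<^sup>+\<nu>. (\<integral>\<^sup>+t\<in>{0..T}. (\<integral>\<^sup>+x\<in>\<omega>. ennreal ((cmod (L2_suminf M (\<lambda>j x.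
      (complex_of_real (\<beta>1 j \<nu>) * \<alpha> j * exp (\<i> * complex_of_real (\<mu> j * t)) -
       complex_of_real (\<beta>2 j \<nu>) * \<gamma> j * exp (- \<i> * complex_of_real (\<mu> j * t))) *
      complex_of_real (\<phi> j x)) x))\<^sup>2) \<partial>M) \<partial>lborel) \<partial>P) =
    ennreal T * (\<Sum>j. ennreal ((cmod (\<alpha> j))\<^sup>2 + (cmod (\<gamma> j))\<^sup>2) * (\<integral>\<^sup>+x\<in>\<omega>. ennreal ((\<phi> j x)\<^sup>2) \<partial>M))"
proof (rule expected_energy[OF P \<omega> T])
  interpret prob_space P by fact
  define p q where "p j t = \<alpha> j * exp (\<i> * complex_of_real (\<mu> j * t))"
    and "q j t = \<gamma> j * exp (- \<i> * complex_of_real (\<mu> j * t))" for j t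
  have norm_p: "cmod (p j t) = cmod (\<alpha> j)" and norm_q: "cmod (q j t) = cmod (\<gamma> j)" for j t
    using norm_exp_i_times[of "- (\<mu> j * t)"] by (simp_all add: p_def q_def norm_mult)
  have [measurable]: "\<beta>1 j \<in> borel_measurable P" "\<beta>2 j \<in> borel_measurable P" for j
    using signs1 signs2 by (simp_all add: independent_signs_def bernoulli_sign_def)
  have [measurable]: "(\<lambda>t. exp (\<i> * complex_of_real (\<mu> j * t))) \<in> borel_measurable borel"
    "(\<lambda>t. exp (- \<i> * complex_of_real (\<mu> j * t))) \<in> borel_measurable borel" for j
    by (intro borel_measurable_continuous_onI continuous_intros)+
  show "(\<lambda>(\<nu>, t). complex_of_real (\<beta>1 j \<nu>) * \<alpha> j * exp (\<i> * complex_of_real (\<mu> j * t)) -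
       complex_of_real (\<beta>2 j \<nu>) * \<gamma> j * exp (- \<i> * complex_of_real (\<mu> j * t)))
      \<in> borel_measurable (P \<Otimes>\<^sub>M lborel)" for j
    by measurable
  show "summable (\<lambda>j. (cmod (\<alpha> j))\<^sup>2 + (cmod (\<gamma> j))\<^sup>2)"
    using \<alpha> \<gamma> by (simp add: ell2_def summable_add)
  show "AE \<nu> in P. \<forall>j t. (cmod (complex_of_real (\<beta>1 j \<nu>) * \<alpha> j * exp (\<i> * complex_of_real (\<mu> j * t)) -
       complex_of_real (\<beta>2 j \<nu>) * \<gamma> j * exp (- \<i> * complex_of_real (\<mu> j * t))))\<^sup>2
      \<le> 2 * ((cmod (\<alpha> j))\<^sup>2 + (cmod (\<gamma> j))\<^sup>2)"
    using independent_signs_AE[OF P signs1] independent_signs_AE[OF P signs2]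
  proof eventually_elim
    case (elim \<nu>)
    have "(cmod (complex_of_real (\<beta>1 j \<nu>) * p j t - complex_of_real (\<beta>2 j \<nu>) * q j t))\<^sup>2
        \<le> 2 * ((cmod (\<alpha> j))\<^sup>2 + (cmod (\<gamma> j))\<^sup>2)" for j t
      using cmod_diff_power2_le[of "complex_of_real (\<beta>1 j \<nu>) * p j t" "complex_of_real (\<beta>2 j \<nu>) * q j t"] elim
      by (simp add: norm_mult norm_p norm_q)
    then show ?case by (simp only: p_def q_def mult.assoc simp_thms)
  qed
  fix j k t
  have int: "integrable P (\<lambda>\<nu>. complex_of_real (X i \<nu> * Y l \<nu>) * c)"
    if X: "independent_signs P X" and Y: "independent_signs P Y" for X Y :: "nat \<Rightarrow> 'p \<Rightarrow> real" and i l c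
  proof -
    have [measurable]: "X i \<in> borel_measurable P" "Y l \<in> borel_measurable P"
      using X Y by (simp_all add: independent_signs_def bernoulli_sign_def)
    have "integrable P (\<lambda>\<nu>. X i \<nu> * Y l \<nu>)"
    proof (rule integrable_const_bound)
      show "AE \<nu> in P. norm (X i \<nu> * Y l \<nu>) \<le> 1"
        using independent_signs_AE[OF P X] independent_signs_AE[OF P Y]
        by eventually_elim (simp add: abs_mult)
    qed simp
    then show ?thesis by (intro integrable_mult_left integrable_of_real) auto
  qed
  have cross': "(\<integral>\<nu>. \<beta>2 j \<nu> * \<beta>1 k \<nu> \<partial>P) = 0"
    using cross[of k j] by (simp add: mult.commute)
  have mean: "(\<integral>\<nu>. complex_of_real (X \<nu> * Y \<nu>) * c \<partial>P) = complex_of_real (\<integral>\<nu>. X \<nu> * Y \<nu> \<partial>P) * c"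
    for X Y :: "'p \<Rightarrow> real" and c
    by (simp only: integral_mult_left_zero integral_complex_of_real)
  have "(\<integral>\<nu>. (complex_of_real (\<beta>1 j \<nu>) * p j t - complex_of_real (\<beta>2 j \<nu>) * q j t) *
      cnj (complex_of_real (\<beta>1 k \<nu>) * p k t - complex_of_real (\<beta>2 k \<nu>) * q k t) \<partial>P) =
    (\<integral>\<nu>. (complex_of_real (\<beta>1 j \<nu> * \<beta>1 k \<nu>) * (p j t * cnj (p k t)) +
          complex_of_real (\<beta>2 j \<nu> * \<beta>2 k \<nu>) * (q j t * cnj (q k t))) -
         (complex_of_real (\<beta>1 j \<nu> * \<beta>2 k \<nu>) * (p j t * cnj (q k t)) +
          complex_of_real (\<beta>2 j \<nu> * \<beta>1 k \<nu>) * (q j t * cnj (p k t))) \<partial>P)"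
    by (intro Bochner_Integration.integral_cong) (simp_all add: algebra_simps)
  also have "\<dots> = (complex_of_real (\<integral>\<nu>. \<beta>1 j \<nu> * \<beta>1 k \<nu> \<partial>P) * (p j t * cnj (p k t)) +
          complex_of_real (\<integral>\<nu>. \<beta>2 j \<nu> * \<beta>2 k \<nu> \<partial>P) * (q j t * cnj (q k t))) -
         (complex_of_real (\<integral>\<nu>. \<beta>1 j \<nu> * \<beta>2 k \<nu> \<partial>P) * (p j t * cnj (q k t)) +
          complex_of_real (\<integral>\<nu>. \<beta>2 j \<nu> * \<beta>1 k \<nu> \<partial>P) * (q j t * cnj (p k t)))"
    by (simp only: Bochner_Integration.integral_diff Bochner_Integration.integral_add mean
        Bochner_Integration.integrable_add int signs1 signs2)
  also have "\<dots> = complex_of_real (if j = k then (cmod (\<alpha> j))\<^sup>2 + (cmod (\<gamma> j))\<^sup>2 else 0)"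
    by (simp add: independent_signs_correlation[OF P signs1] independent_signs_correlation[OF P signs2]
        cross cross' complex_norm_square[symmetric] norm_p norm_q)
  finally show "(\<integral>\<nu>. (complex_of_real (\<beta>1 j \<nu>) * \<alpha> j * exp (\<i> * complex_of_real (\<mu> j * t)) -
       complex_of_real (\<beta>2 j \<nu>) * \<gamma> j * exp (- \<i> * complex_of_real (\<mu> j * t))) *
      cnj (complex_of_real (\<beta>1 k \<nu>) * \<alpha> k * exp (\<i> * complex_of_real (\<mu> k * t)) -
       complex_of_real (\<beta>2 k \<nu>) * \<gamma> k * exp (- \<i> * complex_of_real (\<mu> k * t))) \<partial>P) =
    complex_of_real (if j = k then (cmod (\<alpha> j))\<^sup>2 + (cmod (\<gamma> j))\<^sup>2 else 0)"
    by (simp only: p_def q_def mult.assoc)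
qed simp

lemma C_rand_schroedinger_eq:
  fixes P :: "'p measure"
  assumes P: "prob_space P" and signs: "independent_signs P \<beta>" and \<omega>: "\<omega> \<in> sets M" and T: "0 < T"
    and lam: "\<And>j. lam j > 0"
  shows "C_rand_schroedinger M \<phi> lam P \<beta> T \<omega> = ennreal T * (INF j. \<integral>\<^sup>+x\<in>\<omega>. ennreal ((\<phi> j x)\<^sup>2) \<partial>M)"
proof -
  let ?S = "{c. (\<lambda>j. complex_of_real ((lam j)\<^sup>2) * c j) \<in> ell2 \<and> (\<Sum>j. (lam j) ^ 4 * (cmod (c j))\<^sup>2) = 1}"
  define w where "w c j = (lam j)^4 * (cmod (c j))\<^sup>2" for c :: "nat \<Rightarrow> complex" and j
  have w: "(cmod (complex_of_real ((lam j)\<^sup>2) * c j))\<^sup>2 = w c j" for c j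
    by (simp add: w_def norm_mult power_mult_distrib norm_power flip: power_mult)
  have "C_rand_schroedinger M \<phi> lam P \<beta> T \<omega> =
      (INF c\<in>?S. ennreal T * (\<Sum>j. ennreal (w c j) * (\<integral>\<^sup>+x\<in>\<omega>. ennreal ((\<phi> j x)\<^sup>2) \<partial>M)))"
    unfolding C_rand_schroedinger_def
  proof (rule INF_cong[OF refl])
    fix c assume "c \<in> ?S"
    then have ell2: "(\<lambda>j. complex_of_real ((lam j)\<^sup>2) * c j) \<in> ell2" by simp
    show "(\<integral>\<^sup>+\<nu>. (\<integral>\<^sup>+t\<in>{0..T}. (\<integral>\<^sup>+x\<in>\<omega>. ennreal ((cmod (L2_suminf M (\<lambda>j x.
             complex_of_real ((lam j)\<^sup>2) *
             (complex_of_real (\<beta> j \<nu>) * c j * exp (\<i> * complex_of_real ((lam j)\<^sup>2 * t))) *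
             complex_of_real (\<phi> j x)) x))\<^sup>2) \<partial>M) \<partial>lborel) \<partial>P) =
      ennreal T * (\<Sum>j. ennreal (w c j) * (\<integral>\<^sup>+x\<in>\<omega>. ennreal ((\<phi> j x)\<^sup>2) \<partial>M))"
    proof -
      have "complex_of_real ((lam j)\<^sup>2) * (complex_of_real (\<beta> j \<nu>) * c j * z) =
          complex_of_real (\<beta> j \<nu>) * (complex_of_real ((lam j)\<^sup>2) * c j) * z" for j \<nu> z
        by (simp only: mult_ac)
      then show ?thesis
        using expected_schroedinger_energy[OF P signs \<omega> less_imp_le[OF T] ell2, where \<mu> = "\<lambda>j. (lam j)\<^sup>2"]
        unfolding w by (simp only:)
    qed
  qed
  also have "\<dots> = ennreal T * (INF j. \<integral>\<^sup>+x\<in>\<omega>. ennreal ((\<phi> j x)\<^sup>2) \<partial>M)"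
  proof (rule Inf_weighted_averages)
    show "0 < ennreal T" "ennreal T < top"
      using T by simp_all
    show "w c j \<ge> 0" for c j
      using lam[of j] by (simp add: w_def)
    show "w c sums 1" if "c \<in> ?S" for c
    proof -
      have "summable (w c)"
        using that unfolding ell2_def mem_Collect_eq w by simp
      then show ?thesis
        using that by (simp add: sums_iff w_def[abs_def])
    qed
    show "\<exists>c\<in>?S. \<forall>j. w c j = (if j = k then 1 else 0)" for k
    proof (rule bexI)
      let ?c = "\<lambda>j. if j = k then complex_of_real (1 / (lam k)\<^sup>2) else 0"
      show delta: "\<forall>j. w ?c j = (if j = k then 1 else 0)"
        using lam[of k] by (auto simp: w_def norm_divide norm_power power_divide simp flip: power_mult)
      have "w ?c = (\<lambda>j. if j = k then 1 else 0)"
        using delta by blast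
      then have "w ?c sums 1"
        using sums_single[of k "\<lambda>_. 1::real"] by (simp only:)
      then show "?c \<in> ?S"
        unfolding ell2_def mem_Collect_eq w by (simp only: sums_iff w_def[abs_def] simp_thms)
    qed
  qed
  finally show ?thesis .
qed

lemma C_rand_wave_eq:
  fixes P :: "'p measure"
  assumes P: "prob_space P" and signs1: "independent_signs P \<beta>1" and signs2: "independent_signs P \<beta>2"
    and cross: "\<And>j k. (\<integral>\<nu>. \<beta>1 j \<nu> * \<beta>2 k \<nu> \<partial>P) = 0"
    and \<omega>: "\<omega> \<in> sets M" and T: "0 < T" and lam: "\<And>j. lam j > 0"
  shows "2 * C_rand_wave M \<phi> lam P \<beta>1 \<beta>2 T \<omega> = ennreal T * (INF j. \<integral>\<^sup>+x\<in>\<omega>. ennreal ((\<phi> j x)\<^sup>2) \<partial>M)"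
proof -
  let ?S = "{(a, b). (\<lambda>j. complex_of_real (lam j) * a j) \<in> ell2 \<and>
                     (\<lambda>j. complex_of_real (lam j) * b j) \<in> ell2 \<and>
                     (\<Sum>j. (lam j)\<^sup>2 * ((cmod (a j))\<^sup>2 + (cmod (b j))\<^sup>2)) = 1}"
  define w where "w = (\<lambda>(a, b) j. (lam j)\<^sup>2 * ((cmod (a j :: complex))\<^sup>2 + (cmod (b j :: complex))\<^sup>2))"
  have w: "(cmod (complex_of_real (lam j) * a j))\<^sup>2 + (cmod (complex_of_real (lam j) * b j))\<^sup>2 = w (a, b) j" for a b j
    by (simp add: w_def norm_mult power_mult_distrib distrib_left)
  let ?I = "INF c\<in>?S. ennreal T * (\<Sum>j. ennreal (w c j) * (\<integral>\<^sup>+x\<in>\<omega>. ennreal ((\<phi> j x)\<^sup>2) \<partial>M))"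
  have "C_rand_wave M \<phi> lam P \<beta>1 \<beta>2 T \<omega> = 1 / 2 * ?I"
    unfolding C_rand_wave_def
  proof (rule arg_cong[where f = "(*) (1 / 2)"], rule INF_cong[OF refl], clarify)
    fix a b
    assume a: "(\<lambda>j. complex_of_real (lam j) * a j) \<in> ell2" and b: "(\<lambda>j. complex_of_real (lam j) * b j) \<in> ell2"
    show "(\<integral>\<^sup>+\<nu>. (\<integral>\<^sup>+t\<in>{0..T}. (\<integral>\<^sup>+x\<in>\<omega>. ennreal ((cmod (L2_suminf M (\<lambda>j x.
             complex_of_real (lam j) *
             (complex_of_real (\<beta>1 j \<nu>) * a j * exp (\<i> * complex_of_real (lam j * t)) -
              complex_of_real (\<beta>2 j \<nu>) * b j * exp (- \<i> * complex_of_real (lam j * t))) *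
             complex_of_real (\<phi> j x)) x))\<^sup>2) \<partial>M) \<partial>lborel) \<partial>P) =
      ennreal T * (\<Sum>j. ennreal (w (a, b) j) * (\<integral>\<^sup>+x\<in>\<omega>. ennreal ((\<phi> j x)\<^sup>2) \<partial>M))"
    proof -
      have "complex_of_real (lam j) * (complex_of_real (\<beta>1 j \<nu>) * a j * z - complex_of_real (\<beta>2 j \<nu>) * b j * z') =
          complex_of_real (\<beta>1 j \<nu>) * (complex_of_real (lam j) * a j) * z -
          complex_of_real (\<beta>2 j \<nu>) * (complex_of_real (lam j) * b j) * z'" for j \<nu> z z'
        by (simp only: mult_ac right_diff_distrib)
      then show ?thesis
        using expected_wave_energy[OF P signs1 signs2 cross \<omega> less_imp_le[OF T] a b, where \<mu> = lam]
        unfolding w by (simp only:)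
    qed
  qed
  also have "?I = ennreal T * (INF j. \<integral>\<^sup>+x\<in>\<omega>. ennreal ((\<phi> j x)\<^sup>2) \<partial>M)"
  proof (rule Inf_weighted_averages)
    show "0 < ennreal T" "ennreal T < top"
      using T by simp_all
    show "w c j \<ge> 0" for c j
      by (simp add: w_def split: prod.split)
    show "w c sums 1" if "c \<in> ?S" for c
    proof -
      obtain a b where c: "c = (a, b)" by fastforce
      have "summable (w c)"
        using that unfolding c ell2_def mem_Collect_eq case_prod_conv w[symmetric]
        by (auto intro: summable_add)
      then show ?thesis
        using that by (simp add: sums_iff w_def c)
    qed
    show "\<exists>c\<in>?S. \<forall>j. w c j = (if j = k then 1 else 0)" for k
    proof (rule bexI)
      let ?a = "\<lambda>j. if j = k then complex_of_real (1 / lam k) else 0"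
      show delta: "\<forall>j. w (?a, \<lambda>_. 0) j = (if j = k then 1 else 0)"
        using lam[of k] by (auto simp: w_def norm_divide power_divide)
      have "w (?a, \<lambda>_. 0) = (\<lambda>j. if j = k then 1 else 0)"
        using delta by blast
      then have "w (?a, \<lambda>_. 0) sums 1"
        using sums_single[of k "\<lambda>_. 1::real"] by (simp only:)
      then show "(?a, \<lambda>_. 0) \<in> ?S"
        using w[of _ ?a "\<lambda>_. 0"] unfolding ell2_def mem_Collect_eq case_prod_conv
        by (simp add: sums_iff w_def)
    qed
  qed
  finally have "2 * C_rand_wave M \<phi> lam P \<beta>1 \<beta>2 T \<omega> =
      (2 * (1 / 2)) * (ennreal T * (INF j. \<integral>\<^sup>+x\<in>\<omega>. ennreal ((\<phi> j x)\<^sup>2) \<partial>M))"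
    by (simp only: mult.assoc)
  also have "2 * (1 / 2) = (1 :: ennreal)"
    by (simp add: ennreal_times_divide)
  finally show ?thesis by simp
qed

end

lemma (in spectral_setting) real_orthonormal_system_basis: "real_orthonormal_system (volume_on \<Omega>) \<phi>"
proof
  have L2: "(\<lambda>p. complex_of_real (\<phi> j p)) \<in> L2 (volume_on \<Omega>)" for j
    using eigenfunction[of j] by (simp add: operator_A_def state_space_def)
  fix j k
  show "\<phi> j \<in> borel_measurable (volume_on \<Omega>)"
    using measurable_compose[OF L2_measurable[OF L2[of j]] borel_measurable_Re] by simp
  show "integrable (volume_on \<Omega>) (\<lambda>x. (\<phi> j x)\<^sup>2)"
    using L2[of j] by (simp add: L2_def)
  show "(\<integral>x. \<phi> j x * \<phi> k x \<partial>volume_on \<Omega>) = (if j = k then 1 else 0)"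
    by (rule orthonormal)
qed

theorem theorem2:
  fixes charts :: "('m::{t2_space, second_countable_topology}, 'n::finite) chart set"
    and g :: "('m, 'n) chart \<Rightarrow> 'm \<Rightarrow> real ^ 'n ^ 'n"
    and V :: "'m measure" and \<Omega> \<omega> :: "'m set" and bc :: "'m boundary_condition"
    and \<phi> :: "nat \<Rightarrow> 'm \<Rightarrow> real" and lam :: "nat \<Rightarrow> real"
    and P :: "'p measure" and \<beta>1 \<beta>2 \<beta> :: "nat \<Rightarrow> 'p \<Rightarrow> real" and T :: real
  defines "M \<equiv> riemannian_manifold.volume_on V \<Omega>"
  assumes "spectral_setting charts g V \<Omega> bc \<phi> lam"
    and "prob_space P"
    and "independent_signs P \<beta>1" and "independent_signs P \<beta>2" and "independent_signs P \<beta>"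
    and "\<And>j k. (\<integral>\<nu>. \<beta>1 j \<nu> * \<beta>2 k \<nu> \<partial>P) = 0"
    and "T > 0"
    and "\<omega> \<in> sets M"
  shows "2 * C_rand_wave M \<phi> lam P \<beta>1 \<beta>2 T \<omega> = C_rand_schroedinger M \<phi> lam P \<beta> T \<omega> \<and>
    C_rand_schroedinger M \<phi> lam P \<beta> T \<omega> = ennreal T * (INF j. \<integral>\<^sup>+x\<in>\<omega>. ennreal ((\<phi> j x)\<^sup>2) \<partial>M) \<and>
    ennreal T * (INF j. \<integral>\<^sup>+x\<in>\<omega>. ennreal ((\<phi> j x)\<^sup>2) \<partial>M) = ennreal T * J_functional M \<phi> \<omega>"
proof -
  interpret spectral_setting charts g V \<Omega> bc \<phi> lam by fact
  interpret real_orthonormal_system M \<phi>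
    unfolding M_def by (rule real_orthonormal_system_basis)
  have "2 * C_rand_wave M \<phi> lam P \<beta>1 \<beta>2 T \<omega> = ennreal T * (INF j. \<integral>\<^sup>+x\<in>\<omega>. ennreal ((\<phi> j x)\<^sup>2) \<partial>M)"
    by (rule C_rand_wave_eq) (fact assms lam_pos)+
  moreover have "C_rand_schroedinger M \<phi> lam P \<beta> T \<omega> = ennreal T * (INF j. \<integral>\<^sup>+x\<in>\<omega>. ennreal ((\<phi> j x)\<^sup>2) \<partial>M)"
    by (rule C_rand_schroedinger_eq) (fact assms lam_pos)+
  ultimately show ?thesis by (simp add: J_functional_def)
qed

end
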